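(* Let $N\in\{2,3,\ldots\}$ and $M\in\{1,2,\ldots,N-1\}$. Let $\gamma_1,\ldots,\gamma_N$ be real coefficients such that $\gamma_1,\ldots,\gamma_M$ satisfy $$\Big|\sum_{n=K}^M \gamma_n\Big|<1\quad\text{for each } K=1,2,\ldots,M.$$ Then in the limit of large positive $E$ the stationary system $$E w_n = w_{n+1}+w_{n-1}+i\gamma_n w_n+|w_n|^2 w_n,\quad 1\le n\le N,\qquad w_0=\bar w_1,\quad w_{N+1}=0,$$ admits $2^M$ solutions (distinct up to a gauge transformation) such that, for sufficiently large $E$, the map $E\mapsto \mathbf{w}$ is $C^\infty$ at each of these solutions and there is a positive $E$-independent constant $C$ with $$\big||w_n|^2-E\big|\le C\ \text{ for each } n=1,\ldots,M,\qquad |w_n|^2\le C E^{-1}\ \text{ for each } n=M+1,\ldots,N.$$ That is, there exist $E_0>0$, $C>0$ and $2^M$ $C^\infty$ maps $E\mapsto\mathbf{w}(E)\in\mathbb{C}^N$ on $(E_0,\infty)$ whose values solve the system and satisfy these bounds, with different maps giving solutions that are not gauge-equivalent.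
   Context: Here $E$ is a real parameter and the unknown is $(w_1,\ldots,w_N)\in\mathbb{C}^N$. Extending by $w_{1-n}=\bar w_n$ for $1\le n\le N$, solutions correspond to the $\mathcal{PT}$-invariant vectors $\mathbf{w}=(w_{1-N},\ldots,w_N)^T$ (i.e. $\mathbf{w}=\mathcal{P}\bar{\mathbf{w}}$, where $\mathcal{P}$ reverses the order of components) that give standing waves $\mathbf{q}(t)=\mathbf{w}e^{-iEt}$ of a $\mathcal{PT}$-symmetric discrete nonlinear Schrödinger network with $2N$ sites. The gauge transformation preserving $\mathcal{PT}$-invariance is $\mathbf{w}\mapsto-\mathbf{w}$; two solutions are gauge-equivalent if they are equal or differ by this sign. *)

theory Defs
  imports "HOL-Analysis.Analysis"
begin

(* Vectors (w_1,...,w_N) are functions nat => complex of which only the entries with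
   index in {1..N} matter. The boundary terms w_0 and w_{N+1} are not extra unknowns:
   site_ext reads them off from w as cnj w_1 and 0. *)

definition site_ext :: "nat \<Rightarrow> (nat \<Rightarrow> complex) \<Rightarrow> nat \<Rightarrow> complex" where
  "site_ext N w n = (if n = 0 then cnj (w 1) else if n = N + 1 then 0 else w n)"

definition stationary_solution ::
    "nat \<Rightarrow> (nat \<Rightarrow> real) \<Rightarrow> real \<Rightarrow> (nat \<Rightarrow> complex) \<Rightarrow> bool" where
  "stationary_solution N \<gamma> E w \<longleftrightarrow>
     (\<forall>n\<in>{1..N}. of_real E * w n =
        site_ext N w (n + 1) + site_ext N w (n - 1)
        + \<i> * of_real (\<gamma> n) * w n + of_real ((cmod (w n))\<^sup>2) * w n)"

definition gauge_equivalent :: "nat \<Rightarrow> (nat \<Rightarrow> complex) \<Rightarrow> (nat \<Rightarrow> complex) \<Rightarrow> bool" where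
  "gauge_equivalent N v w \<longleftrightarrow>
     (\<forall>n\<in>{1..N}. v n = w n) \<or> (\<forall>n\<in>{1..N}. v n = - w n)"

definition nth_vector_derivative ::
    "nat \<Rightarrow> (real \<Rightarrow> 'a::real_normed_vector) \<Rightarrow> real \<Rightarrow> 'a" where
  "nth_vector_derivative k f = ((\<lambda>g t. vector_derivative g (at t)) ^^ k) f"

(* Intended for open S, where the values of f outside S are irrelevant. Continuity of the
   derivatives need not be asked for, since each of them is itself differentiable. *)

definition C_infinity_on :: "real set \<Rightarrow> (real \<Rightarrow> 'a::real_normed_vector) \<Rightarrow> bool" where
  "C_infinity_on S f \<longleftrightarrow> (\<forall>k. \<forall>t\<in>S. nth_vector_derivative k f differentiable (at t))"

end

theory Submission
  imports Defs
begin

text \<open>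
  The system is solved by shooting from site \<open>N\<close>. With \<open>w\<^sub>N\<^sub>+\<^sub>1 = 0\<close>, the recursion determines all
  \<open>w\<^sub>n = w\<^sub>N v\<^sub>n\<close> down to \<open>w\<^sub>0\<close>, where the \<open>v\<^sub>n\<close> are complex polynomials in the real variables \<open>E\<close> and \<open>x = |w\<^sub>N|\<^sup>2\<close>.
  Since the recursion commutes with constant phases, the boundary condition \<open>w\<^sub>0 = cnj w\<^sub>1\<close> can be met by
  rotating the vector as soon as \<open>|v\<^sub>0| = |v\<^sub>1|\<close>, so a single real equation in \<open>x\<close> and \<open>E\<close> remains.

  Put \<open>p = |w\<^sub>n|\<^sup>2\<close>, \<open>r = w\<^sub>n\<^sub>+\<^sub>1 / w\<^sub>n\<close>, \<open>u = w\<^sub>n\<^sub>-\<^sub>1 / w\<^sub>n = E - i \<gamma>\<^sub>n - p - r\<close>. On the tail \<open>u\<close> is of order \<open>E\<close>. On the sites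
  \<open>n \<le> M\<close> both \<open>|w\<^sub>n|\<^sup>2\<close> and \<open>|w\<^sub>n\<^sub>-\<^sub>1|\<^sup>2\<close> are within \<open>3\<close> of \<open>E\<close>, so \<open>|u| = 1 + O(1/E)\<close>, while
  \<open>Im u = - (\<gamma>\<^sub>n + \<dots> + \<gamma>\<^sub>M) + O(1/E)\<close> has modulus below \<open>1\<close>; hence \<open>Re u\<close> is known up to its sign. For each choice
  of the \<open>M\<close> signs, \<open>r\<close> is nearly constant while \<open>p\<close> expands by a factor of order at least \<open>E\<close> in every step,
  so the final equation has exactly one root in an open region, the root is simple, and it depends smoothly
  on \<open>E\<close> by the implicit function theorem in one variable.
\<close>

subsection \<open>One step of the recursion\<close>

text \<open>Here \<open>p x\<close> stands for \<open>|w\<^sub>n|\<^sup>2\<close> and \<open>r x\<close> for \<open>w\<^sub>n\<^sub>+\<^sub>1 / w\<^sub>n\<close>, and \<open>\<Omega>\<close> is the set of parameters \<open>x\<close> for which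
  the sites from \<open>n\<close> on have the prescribed sizes and signs.\<close>

definition controlled ::
    "real \<Rightarrow> real \<Rightarrow> complex \<Rightarrow> real set \<Rightarrow> real set \<Rightarrow> (real \<Rightarrow> real) \<Rightarrow> (real \<Rightarrow> complex) \<Rightarrow> bool" where
  "controlled E K c I \<Omega> p r \<longleftrightarrow>
     p ` \<Omega> = I \<and> (\<forall>x\<in>\<Omega>. cmod (r x - c) \<le> K / E) \<and>
     (\<forall>x\<in>\<Omega>. \<forall>y\<in>\<Omega>. cmod (r x - r y) \<le> K / E * \<bar>p x - p y\<bar> \<and> \<bar>x - y\<bar> \<le> \<bar>p x - p y\<bar>)"

text \<open>The bound of \<open>|x - y|\<close> by \<open>|p x - p y|\<close> makes \<open>p\<close>
  injective on \<open>\<Omega>\<close>, so \<open>p\<close> can serve as the coordinate instead of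
  \<open>x\<close>. In it \<open>r\<close> is Lipschitz, which supplies the continuity for
  intermediate value arguments without any topological information on
  \<open>\<Omega>\<close>.\<close>

lemma controlled_inverse:
  assumes "controlled E K c I \<Omega> p r" "K / E \<ge> 0"
  obtains \<xi> where "\<And>t. t \<in> I \<Longrightarrow> \<xi> t \<in> \<Omega> \<and> p (\<xi> t) = t" "continuous_on I (\<lambda>t. r (\<xi> t))"
proof -
  have "\<forall>t\<in>I. \<exists>x. x \<in> \<Omega> \<and> p x = t"
    using assms unfolding controlled_def by (metis imageE)
  then obtain \<xi> where \<xi>: "\<And>t. t \<in> I \<Longrightarrow> \<xi> t \<in> \<Omega> \<and> p (\<xi> t) = t"
    by metis
  have "(K / E)-lipschitz_on I (\<lambda>t. r (\<xi> t))"
  proof (rule lipschitz_onI)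
    fix s t assume "s \<in> I" "t \<in> I"
    then show "dist (r (\<xi> s)) (r (\<xi> t)) \<le> K / E * dist s t"
      using assms(1) \<xi>[of s] \<xi>[of t] unfolding controlled_def dist_norm real_norm_def by metis
  qed (use assms in auto)
  then show thesis
    using that \<xi> lipschitz_on_continuous_on by blast
qed

lemma abs_diff_le: "\<bar>a\<bar> - \<bar>b\<bar> \<le> \<bar>a + b\<bar>" for a b :: real
  by linarith

lemma abs_cmod_sq_diff_le:
  fixes u v :: complex
  assumes "cmod u \<le> B" "cmod v \<le> B"
  shows "\<bar>(cmod u)\<^sup>2 - (cmod v)\<^sup>2\<bar> \<le> 2 * B * cmod (u - v)"
proof -
  have "\<bar>(cmod u)\<^sup>2 - (cmod v)\<^sup>2\<bar> = \<bar>cmod u - cmod v\<bar> * (cmod u + cmod v)"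
    by (simp add: power2_eq_square square_diff_square_factored abs_mult)
  also have "\<dots> \<le> cmod (u - v) * (2 * B)"
    using assms by (intro mult_mono norm_triangle_ineq3) auto
  finally show ?thesis by (simp add: mult_ac)
qed

lemma cmod_inverse_diff:
  fixes u v :: complex
  assumes "m \<le> cmod u" "m' \<le> cmod v" "m > 0" "m' > 0"
  shows "cmod (1 / u - 1 / v) \<le> cmod (u - v) / (m * m')"
proof -
  have "u \<noteq> 0" "v \<noteq> 0" using assms by auto
  then have "1 / u - 1 / v = (v - u) / (u * v)" by (simp add: field_simps)
  then have "cmod (1 / u - 1 / v) = cmod (u - v) / (cmod u * cmod v)"
    by (simp add: norm_divide norm_mult norm_minus_commute)
  also have "\<dots> \<le> cmod (u - v) / (m * m')"
    using assms by (intro divide_left_mono mult_mono mult_pos_pos) auto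
  finally show ?thesis .
qed

text \<open>Here \<open>|u|\<close> lies between \<open>E / 2\<close> and \<open>2 * E\<close>, so
  \<open>1 / u\<close> is again of order \<open>1 / E\<close> and \<open>p\<close> is stretched by a
  factor of order \<open>E^2\<close>. The target interval is a parameter because the last tail step
  has to land around \<open>E\<close>, the earlier ones in the unit interval.\<close>

lemma controlled_tail_step:
  fixes p :: "real \<Rightarrow> real" and r :: "real \<Rightarrow> complex" and E \<gamma> :: real
  assumes E: "E \<ge> 100" and \<gamma>: "\<bar>\<gamma>\<bar> \<le> E / 4" and ctl: "controlled E 2 0 {0<..<1} \<Omega> p r"
    and ab: "0 \<le> a" "b \<le> E\<^sup>2 / 8"
  defines "u \<equiv> \<lambda>x. complex_of_real E - \<i> * of_real \<gamma> - of_real (p x) - r x"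
  defines "p' \<equiv> \<lambda>x. p x * (cmod (u x))\<^sup>2"
  shows "controlled E 2 0 {a<..<b} {x\<in>\<Omega>. p' x \<in> {a<..<b}} p' (\<lambda>x. 1 / u x)"
proof -
  define \<delta> where "\<delta> = 2 / E"
  have \<delta>: "0 \<le> \<delta>" "\<delta> \<le> 1" using E by (auto simp: \<delta>_def)
  have px: "0 < p x" "p x < 1" and rx: "cmod (r x) \<le> \<delta>" if "x \<in> \<Omega>" for x
    using ctl that unfolding controlled_def \<delta>_def by auto
  have lip: "cmod (r x - r y) \<le> \<delta> * \<bar>p x - p y\<bar>" and inj: "\<bar>x - y\<bar> \<le> \<bar>p x - p y\<bar>"
    if "x \<in> \<Omega>" "y \<in> \<Omega>" for x y
    using ctl that unfolding controlled_def \<delta>_def by auto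
  have ubd: "E / 2 \<le> cmod (u x)" "cmod (u x) \<le> 2 * E" if "x \<in> \<Omega>" for x
  proof -
    have "E / 2 \<le> Re (u x)"
      using px[OF that] rx[OF that] \<delta> abs_Re_le_cmod[of "r x"] E unfolding u_def by simp
    then show "E / 2 \<le> cmod (u x)" using complex_Re_le_cmod[of "u x"] by linarith
    have "cmod (u x) \<le> cmod (of_real E) + cmod (\<i> * of_real \<gamma>) + cmod (of_real (p x)) + cmod (r x)"
      unfolding u_def by (meson norm_triangle_ineq4 order_trans add_mono order_refl)
    also have "\<dots> \<le> 2 * E"
      using px[OF that] rx[OF that] \<delta> E \<gamma> by (simp add: norm_mult)
    finally show "cmod (u x) \<le> 2 * E" .
  qed
  have du: "cmod (u x - u y) \<le> 2 * \<bar>p x - p y\<bar>" if "x \<in> \<Omega>" "y \<in> \<Omega>" for x y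
  proof -
    have "u x - u y = - of_real (p x - p y) - (r x - r y)" unfolding u_def by simp
    then have "cmod (u x - u y) \<le> \<bar>p x - p y\<bar> + cmod (r x - r y)"
      by (metis norm_minus_cancel norm_of_real norm_triangle_ineq4)
    also have "\<dots> \<le> \<bar>p x - p y\<bar> + 1 * \<bar>p x - p y\<bar>"
      using lip[OF that] mult_right_mono[OF \<delta>(2), of "\<bar>p x - p y\<bar>"] by auto
    finally show ?thesis by simp
  qed
  \<comment> \<open>The change of the factor \<open>p\<close> contributes at least
    \<open>(E / 2)^2\<close>, the change of \<open>|u|^2\<close> takes away at most
    \<open>8 * E\<close> because \<open>p < 1\<close>; at least \<open>E^2 / 8\<close>
    remains.\<close>
  have dp: "E\<^sup>2 / 8 * \<bar>p x - p y\<bar> \<le> \<bar>p' x - p' y\<bar>" if xy: "x \<in> \<Omega>" "y \<in> \<Omega>" for x y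
  proof -
    have "\<bar>(cmod (u x))\<^sup>2 - (cmod (u y))\<^sup>2\<bar> \<le> 2 * (2 * E) * cmod (u x - u y)"
      by (intro abs_cmod_sq_diff_le ubd that)
    also have "\<dots> \<le> 2 * (2 * E) * (2 * \<bar>p x - p y\<bar>)"
      using du[OF that] E by (intro mult_left_mono) auto
    finally have 1: "\<bar>(cmod (u x))\<^sup>2 - (cmod (u y))\<^sup>2\<bar> \<le> 8 * E * \<bar>p x - p y\<bar>" by simp
    have "\<bar>p y * ((cmod (u x))\<^sup>2 - (cmod (u y))\<^sup>2)\<bar> \<le> \<bar>(cmod (u x))\<^sup>2 - (cmod (u y))\<^sup>2\<bar>"
      using px[OF xy(2)] unfolding abs_mult by (intro mult_left_le_one_le) auto
    note 2 = order_trans[OF this 1]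
    have "(E / 2)\<^sup>2 \<le> (cmod (u x))\<^sup>2" using ubd(1)[OF xy(1)] E by (intro power_mono) auto
    then have "(E / 2)\<^sup>2 * \<bar>p x - p y\<bar> \<le> \<bar>(p x - p y) * (cmod (u x))\<^sup>2\<bar>"
      by (simp add: abs_mult mult.commute mult_left_mono)
    moreover have "p' x - p' y = (p x - p y) * (cmod (u x))\<^sup>2 + p y * ((cmod (u x))\<^sup>2 - (cmod (u y))\<^sup>2)"
      unfolding p'_def by (simp add: algebra_simps)
    ultimately have "(E / 2)\<^sup>2 * \<bar>p x - p y\<bar> - 8 * E * \<bar>p x - p y\<bar> \<le> \<bar>p' x - p' y\<bar>"
      using 2 abs_diff_le[of "(p x - p y) * (cmod (u x))\<^sup>2" "p y * ((cmod (u x))\<^sup>2 - (cmod (u y))\<^sup>2)"] by simp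
    moreover have "E\<^sup>2 / 8 \<le> (E / 2)\<^sup>2 - 8 * E"
      using mult_right_mono[of 100 E E] E by (simp add: power2_eq_square)
    then have "E\<^sup>2 / 8 * \<bar>p x - p y\<bar> \<le> ((E / 2)\<^sup>2 - 8 * E) * \<bar>p x - p y\<bar>"
      by (intro mult_right_mono) auto
    ultimately show ?thesis by (simp add: algebra_simps)
  qed
  have E8: "E\<^sup>2 / 8 \<ge> 1" using mult_mono[of 100 E 100 E] E by (simp add: power2_eq_square)
  have dp1: "\<bar>p x - p y\<bar> \<le> \<bar>p' x - p' y\<bar>" if "x \<in> \<Omega>" "y \<in> \<Omega>" for x y
    using dp[OF that] mult_right_mono[OF E8, of "\<bar>p x - p y\<bar>"] by auto
  obtain \<xi> where \<xi>: "\<And>t. t \<in> {0<..<1} \<Longrightarrow> \<xi> t \<in> \<Omega> \<and> p (\<xi> t) = t"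
    and cont: "continuous_on {0<..<1} (\<lambda>t. r (\<xi> t))"
    using controlled_inverse[OF ctl] E by auto
  have surj: "\<exists>x\<in>\<Omega>. p' x = s" if s: "a < s" "s < b" for s
  proof -
    have E0: "E > 0" "E\<^sup>2 > 0" using E by auto
    \<comment> \<open>Since \<open>|u|\<close> lies between \<open>E / 2\<close> and
      \<open>2 * E\<close>, the product \<open>t * |u|^2\<close> is at most \<open>s\<close> at
      \<open>t1\<close> and at least \<open>s\<close> at \<open>t2\<close>. Below, \<open>?g\<close>
      is \<open>p'\<close> in the coordinate \<open>t = p x\<close>.\<close>
    define t1 t2 where "t1 = s / (4 * E\<^sup>2)" and "t2 = 4 * s / E\<^sup>2"
    have s0: "0 < s" "8 * s < E\<^sup>2" using s ab by auto
    have t: "0 < t1" "t1 \<le> t2" "t2 < 1"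
      unfolding t1_def t2_def using s0 E0 by (auto simp: field_simps)
    then have sub: "{t1..t2} \<subseteq> {0<..<1}" by auto
    let ?g = "\<lambda>t. t * (cmod (complex_of_real E - \<i> * of_real \<gamma> - of_real t - r (\<xi> t)))\<^sup>2"
    have g: "?g t = p' (\<xi> t)" if "t \<in> {0<..<1}" for t
      using \<xi>[OF that] unfolding p'_def u_def by simp
    have "continuous_on {t1..t2} ?g"
      by (intro continuous_intros continuous_on_subset[OF cont sub])
    moreover have "?g t1 \<le> s"
    proof -
      have x: "\<xi> t1 \<in> \<Omega>" "p (\<xi> t1) = t1" using \<xi>[of t1] t by auto
      have "(cmod (u (\<xi> t1)))\<^sup>2 \<le> (2 * E)\<^sup>2" using ubd(2)[OF x(1)] by (intro power_mono) auto
      then have "t1 * (cmod (u (\<xi> t1)))\<^sup>2 \<le> t1 * (2 * E)\<^sup>2" using t by (intro mult_left_mono) auto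
      also have "\<dots> = s" using E0 by (simp add: t1_def field_simps)
      finally show ?thesis using g[of t1] t x unfolding p'_def by simp
    qed
    moreover have "s \<le> ?g t2"
    proof -
      have x: "\<xi> t2 \<in> \<Omega>" "p (\<xi> t2) = t2" using \<xi>[of t2] t by auto
      have "(E / 2)\<^sup>2 \<le> (cmod (u (\<xi> t2)))\<^sup>2" using ubd(1)[OF x(1)] E0 by (intro power_mono) auto
      then have "t2 * (E / 2)\<^sup>2 \<le> t2 * (cmod (u (\<xi> t2)))\<^sup>2" using t by (intro mult_left_mono) auto
      moreover have "t2 * (E / 2)\<^sup>2 = s" using E0 by (simp add: t2_def field_simps)
      ultimately show ?thesis using g[of t2] t x unfolding p'_def by simp
    qed
    ultimately obtain t3 where "t1 \<le> t3" "t3 \<le> t2" "?g t3 = s"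
      using IVT'[of ?g t1 s t2] t by auto
    then show ?thesis using g[of t3] \<xi>[of t3] t by (intro bexI[of _ "\<xi> t3"]) auto
  qed
  show ?thesis
    unfolding controlled_def
  proof (intro conjI ballI)
    show "p' ` {x \<in> \<Omega>. p' x \<in> {a<..<b}} = {a<..<b}"
      using surj by (fastforce simp: image_iff)
  next
    fix x assume "x \<in> {x \<in> \<Omega>. p' x \<in> {a<..<b}}"
    then have "1 / cmod (u x) \<le> 1 / (E / 2)"
      using ubd(1)[of x] E by (intro divide_left_mono) (auto intro!: mult_pos_pos)
    then show "cmod (1 / u x - 0) \<le> 2 / E" by (simp add: norm_divide)
  next
    fix x y assume "x \<in> {x \<in> \<Omega>. p' x \<in> {a<..<b}}" "y \<in> {x \<in> \<Omega>. p' x \<in> {a<..<b}}"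
    then have xy: "x \<in> \<Omega>" "y \<in> \<Omega>" by auto
    show "\<bar>x - y\<bar> \<le> \<bar>p' x - p' y\<bar>" using inj[OF xy] dp1[OF xy] by linarith
    have "cmod (1 / u x - 1 / u y) \<le> cmod (u x - u y) / (E / 2 * (E / 2))"
      using ubd xy E by (intro cmod_inverse_diff) auto
    also have "\<dots> \<le> (2 * \<bar>p x - p y\<bar>) / (E / 2 * (E / 2))"
      using du[OF xy] by (intro divide_right_mono) auto
    also have "\<dots> \<le> 2 * \<bar>p' x - p' y\<bar> / (E / 2 * (E / 2))"
      using dp1[OF xy] by (intro divide_right_mono) auto
    \<comment> \<open>As \<open>8 / E\<close> is at most 2, the constant 2 in
      \<open>controlled\<close> reproduces itself along the tail.\<close>
    also have "\<dots> = (8 / E) * (\<bar>p' x - p' y\<bar> / E)" by (simp add: field_simps)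
    also have "\<dots> \<le> 2 * (\<bar>p' x - p' y\<bar> / E)"
      using E by (intro mult_right_mono) (auto simp: divide_le_eq)
    finally show "cmod (1 / u x - 1 / u y) \<le> 2 / E * \<bar>p' x - p' y\<bar>" by simp
  qed
qed

text \<open>Both \<open>p\<close> and \<open>p'\<close> lie within 3 of \<open>E\<close>, so
  \<open>|u|^2 = p' / p\<close> is close to 1, while \<open>Im u\<close> is close to
  \<open>- S\<close>; hence \<open>Re u\<close> is close to \<open>\<sigma> * q\<close>. To leading
  order \<open>u\<close> moves by minus the change of \<open>p\<close>, so \<open>|u|^2\<close> has
  slope about \<open>- 2 * \<sigma> * q\<close> and \<open>p'\<close> expands by order
  \<open>q * E\<close>: this is where \<open>q > 0\<close>, that is \<open>|S| < 1\<close>, enters.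
  The last two conclusions prepare the crossing argument.\<close>

lemma controlled_nonlinear_step:
  fixes p :: "real \<Rightarrow> real" and r :: "real \<Rightarrow> complex" and E K S q \<gamma> \<sigma> :: real and c :: complex
  assumes q: "q > 0" "q\<^sup>2 + S\<^sup>2 = 1" and c: "cmod c \<le> 1" "Im c = S - \<gamma>"
    and \<sigma>: "\<sigma> = 1 \<or> \<sigma> = -1" and K: "K > 0"
    and \<mu>: "\<mu> = (12 + 3 * K) / q + K"
    and E: "E \<ge> 3 + 24 / q\<^sup>2" "K / E \<le> q\<^sup>2 / 16" "\<mu> / E \<le> q / 2" "(8 * K + 4) / E \<le> q / 2"
      "4 / (q * E) \<le> 1 / 2"
    and ctl: "controlled E K c {E - 3<..<E + 3} \<Omega> p r"
  defines "u \<equiv> \<lambda>x. complex_of_real E - \<i> * of_real \<gamma> - of_real (p x) - r x"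
  defines "p' \<equiv> \<lambda>x. p x * (cmod (u x))\<^sup>2"
  defines "\<Omega>' \<equiv> {x\<in>\<Omega>. p' x \<in> {E - 3<..<E + 3} \<and> \<sigma> * Re (u x) > 0}"
  shows "controlled E (2 * \<mu> + 32 / q) (Complex (\<sigma> * q) S) {E - 3<..<E + 3} \<Omega>' p' (\<lambda>x. 1 / u x)"
    and "\<And>x. x \<in> \<Omega>' \<Longrightarrow> \<bar>p x - E\<bar> \<le> 5 / 2"
    and "\<And>x y. x \<in> \<Omega>' \<Longrightarrow> y \<in> \<Omega>' \<Longrightarrow> \<bar>p x - p y\<bar> \<le> \<bar>p' x - p' y\<bar> / 2"
proof -
  define \<epsilon> where "\<epsilon> = K / E"
  have "q\<^sup>2 \<le> 1" "S\<^sup>2 \<le> 1"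
    using q(2) zero_le_power2[of q] zero_le_power2[of S] by linarith+
  then have q1: "q\<^sup>2 \<le> 1" "q \<le> 1" "\<bar>S\<bar> \<le> 1"
    by (auto simp: abs_square_le_1)
  have "24 / q\<^sup>2 \<ge> 24" using q q1 by (auto simp: le_divide_eq)
  then have E15: "E \<ge> 15" using E by linarith
  have \<epsilon>: "0 < \<epsilon>" "\<epsilon> \<le> q\<^sup>2 / 16" "\<epsilon> \<le> 1 / 16" "\<epsilon> < q / 2"
  proof -
    show "0 < \<epsilon>" "\<epsilon> \<le> q\<^sup>2 / 16" using E(2) K E15 by (auto simp: \<epsilon>_def)
    moreover have "q\<^sup>2 \<le> q" using q q1 by (simp add: power2_eq_square mult_left_le)
    ultimately show "\<epsilon> \<le> 1 / 16" "\<epsilon> < q / 2" using q q1 by linarith+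
  qed
  have "\<mu> > 0" using q K unfolding \<mu> by (auto intro: add_pos_pos)
  have \<mu>E: "0 \<le> \<mu> / E" using E15 \<open>\<mu> > 0\<close> by auto
  have \<mu>E2: "\<mu> / E \<le> 1 / 2" using E(3) q1(2) by linarith
  have px: "E - 3 < p x" "p x < E + 3" and rx: "cmod (r x - c) \<le> \<epsilon>" if "x \<in> \<Omega>" for x
    using ctl that unfolding controlled_def \<epsilon>_def by auto
  have lip: "cmod (r x - r y) \<le> \<epsilon> * \<bar>p x - p y\<bar>" and inj: "\<bar>x - y\<bar> \<le> \<bar>p x - p y\<bar>"
    if "x \<in> \<Omega>" "y \<in> \<Omega>" for x y
    using ctl that unfolding controlled_def \<epsilon>_def by auto
  have Reu: "Re (u x) = E - p x - Re c - Re (r x - c)" and Imu: "Im (u x) = - S - Im (r x - c)" for x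
    using c unfolding u_def by auto
  have Imr: "\<bar>Im (r x - c)\<bar> \<le> \<epsilon>" and Rer: "\<bar>Re (r x - c)\<bar> \<le> \<epsilon>" if "x \<in> \<Omega>" for x
    using rx[OF that] abs_Im_le_cmod[of "r x - c"] abs_Re_le_cmod[of "r x - c"] by linarith+
  have Im2: "\<bar>(Im (u x))\<^sup>2 - S\<^sup>2\<bar> \<le> 3 * \<epsilon>" if "x \<in> \<Omega>" for x
  proof -
    have "(Im (u x))\<^sup>2 - S\<^sup>2 = Im (r x - c) * (2 * S + Im (r x - c))"
      unfolding Imu by (simp add: power2_eq_square algebra_simps)
    moreover have "\<bar>2 * S + Im (r x - c)\<bar> \<le> 3"
      using Imr[OF that] \<epsilon> q1 by linarith
    ultimately show ?thesis
      using mult_mono[OF Imr[OF that], of "\<bar>2 * S + Im (r x - c)\<bar>" 3] \<epsilon> by (simp add: abs_mult)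
  qed
  have sub: "x \<in> \<Omega>" if "x \<in> \<Omega>'" for x using that unfolding \<Omega>'_def by auto
  have n2: "\<bar>(cmod (u x))\<^sup>2 - 1\<bar> \<le> 12 / E" if "x \<in> \<Omega>'" for x
  proof -
    have x: "x \<in> \<Omega>" "E - 3 < p' x" "p' x < E + 3" using that unfolding \<Omega>'_def by auto
    have "(cmod (u x))\<^sup>2 - 1 = (p' x - p x) / p x"
      using px[OF x(1)] E15 unfolding p'_def by (simp add: field_simps)
    then have "\<bar>(cmod (u x))\<^sup>2 - 1\<bar> = \<bar>p' x - p x\<bar> / p x"
      using px[OF x(1)] E15 by (simp add: abs_divide)
    also have "\<dots> \<le> 6 / (E / 2)"
      using px[OF x(1)] x E15 by (intro frac_le) auto
    finally show ?thesis by simp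
  qed
  have R: "\<bar>\<sigma> * Re (u x) - q\<bar> \<le> (12 + 3 * K) / q / E" if "x \<in> \<Omega>'" for x
  proof -
    \<comment> \<open>The sign condition gives \<open>a + q >= q\<close>, which turns closeness of
      \<open>a^2\<close> and \<open>q^2\<close> into closeness of \<open>a\<close> and
      \<open>q\<close>.\<close>
    define a where "a = \<sigma> * Re (u x)"
    have a: "a > 0" "a\<^sup>2 = (Re (u x))\<^sup>2" using that \<sigma> unfolding \<Omega>'_def a_def by auto
    have "a\<^sup>2 - q\<^sup>2 = ((cmod (u x))\<^sup>2 - 1) - ((Im (u x))\<^sup>2 - S\<^sup>2)"
      using q(2) unfolding a cmod_power2 by linarith
    then have "\<bar>a\<^sup>2 - q\<^sup>2\<bar> \<le> 12 / E + 3 * \<epsilon>"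
      using n2[OF that] Im2[OF sub[OF that]] by linarith
    also have "\<dots> = (12 + 3 * K) / E" by (simp add: \<epsilon>_def add_divide_distrib)
    finally have "\<bar>a\<^sup>2 - q\<^sup>2\<bar> \<le> (12 + 3 * K) / E" .
    moreover have "\<bar>a\<^sup>2 - q\<^sup>2\<bar> = \<bar>a - q\<bar> * (a + q)"
      using a(1) q(1) by (simp add: power2_eq_square square_diff_square_factored abs_mult)
    moreover have "\<bar>a - q\<bar> * (a + q) \<ge> \<bar>a - q\<bar> * q"
      using a by (intro mult_left_mono) auto
    ultimately have "\<bar>a - q\<bar> * q \<le> (12 + 3 * K) / E" by linarith
    then have "\<bar>a - q\<bar> \<le> (12 + 3 * K) / E / q" using q(1) by (subst pos_le_divide_eq)
    then show ?thesis unfolding a_def by (simp add: mult.commute)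
  qed
  \<comment> \<open>\<open>\<mu>\<close> adds the error of the imaginary part of \<open>u\<close> to
    that of the real part.\<close>
  have \<mu>': "(12 + 3 * K) / q / E + \<epsilon> = \<mu> / E" unfolding \<mu> \<epsilon>_def by (simp add: add_divide_distrib)
  \<comment> \<open>\<open>w\<close> is the limit of \<open>u\<close>. It has modulus 1, so its
    inverse is its conjugate, which is the new centre.\<close>
  define w where "w = Complex (\<sigma> * q) (- S)"
  have w: "cmod w = 1" using q(2) \<sigma> unfolding w_def by (auto simp: cmod_def)
  have uw: "cmod (u x - w) \<le> \<mu> / E" if "x \<in> \<Omega>'" for x
  proof -
    have "\<bar>Re (u x) - \<sigma> * q\<bar> = \<bar>\<sigma> * Re (u x) - q\<bar>" using \<sigma> by auto
    then have "\<bar>Re (u x - w)\<bar> \<le> (12 + 3 * K) / q / E" using R[OF that] unfolding w_def by simp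
    moreover have "\<bar>Im (u x - w)\<bar> \<le> \<epsilon>"
      using Imr[OF sub[OF that]] unfolding w_def minus_complex.sel Imu by simp
    ultimately show ?thesis using cmod_le[of "u x - w"] \<mu>' by linarith
  qed
  have ubd: "1 / 2 \<le> cmod (u x)" "cmod (u x) \<le> 2" if "x \<in> \<Omega>'" for x
    using uw[OF that] \<mu>E2 w norm_triangle_ineq3[of "u x" w] by linarith+
  have Rpos: "q / 2 \<le> \<sigma> * Re (u x)" if "x \<in> \<Omega>'" for x
    using R[OF that] \<mu>' \<epsilon> E(3) by linarith
  \<comment> \<open>\<open>E - p x\<close> is the sum of \<open>Re u\<close>, at most
    \<open>3 / 2 - \<epsilon>\<close> in modulus, of \<open>Re c\<close>, at most 1, and of a
    deviation of at most \<open>\<epsilon>\<close>. The value \<open>5 / 2\<close> is strictly below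
    the half-width 3 of the window, which the crossing argument exploits.\<close>
  show pE: "\<bar>p x - E\<bar> \<le> 5 / 2" if "x \<in> \<Omega>'" for x
  proof -
    have "\<bar>Re (u x)\<bar> = \<sigma> * Re (u x)" using \<sigma> that unfolding \<Omega>'_def by auto
    then have "\<bar>Re (u x)\<bar> \<le> 1 + 1 / 2 - \<epsilon>" using R[OF that] \<mu>' \<mu>E2 q1 by linarith
    moreover have "\<bar>Re c\<bar> \<le> 1" using abs_Re_le_cmod[of c] c by linarith
    ultimately show ?thesis using Reu[of x] Rer[OF sub[OF that]] by linarith
  qed
  have dp: "\<bar>p x - p y\<bar> \<le> 4 / (q * E) * \<bar>p' x - p' y\<bar>" if xy: "x \<in> \<Omega>'" "y \<in> \<Omega>'" for x y
  proof -
    define \<tau> where "\<tau> = \<bar>p x - p y\<bar>"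
    have p0: "p x > E / 2" "p y > E / 2" using px[OF sub[OF xy(1)]] px[OF sub[OF xy(2)]] E15 by auto
    have u2: "(cmod (u y))\<^sup>2 \<le> 2"
      using n2[OF xy(2)] E15 order_trans[of "(cmod (u y))\<^sup>2 - 1" "12 / E" 1] by auto
    \<comment> \<open>\<open>D\<close> is estimated twice: from above through
      \<open>p' = p * |u|^2\<close>, and from below through the definition of \<open>u\<close>,
      where the term \<open>A * (p x - p y)\<close> dominates. Comparison of the two gives the
      expansion.\<close>
    define D where "D = (cmod (u x))\<^sup>2 - (cmod (u y))\<^sup>2"
    have "D * p x = (p' x - p' y) - (cmod (u y))\<^sup>2 * (p x - p y)"
      unfolding p'_def D_def by (simp add: algebra_simps)
    then have "\<bar>D\<bar> * p x \<le> \<bar>p' x - p' y\<bar> + (cmod (u y))\<^sup>2 * \<tau>"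
      using p0 E15 abs_triangle_ineq4[of "p' x - p' y" "(cmod (u y))\<^sup>2 * (p x - p y)"]
      unfolding \<tau>_def by (simp add: abs_mult[symmetric]) (simp add: abs_mult)
    also have "\<dots> \<le> \<bar>p' x - p' y\<bar> + 2 * \<tau>"
      using u2 unfolding \<tau>_def by (intro add_left_mono mult_right_mono) auto
    finally have "\<bar>D\<bar> * (E / 2) \<le> \<bar>p' x - p' y\<bar> + 2 * \<tau>"
      using mult_left_mono[of "E / 2" "p x" "\<bar>D\<bar>"] p0 by linarith
    then have D1: "\<bar>D\<bar> \<le> 2 / E * \<bar>p' x - p' y\<bar> + 4 / E * \<tau>"
      using E15 by (simp add: field_simps)
    have Dr: "\<bar>Re (r x - r y)\<bar> \<le> \<epsilon> * \<tau>" "\<bar>Im (r x - r y)\<bar> \<le> \<epsilon> * \<tau>"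
      using lip[OF sub[OF xy(1)] sub[OF xy(2)]] abs_Re_le_cmod[of "r x - r y"] abs_Im_le_cmod[of "r x - r y"]
      unfolding \<tau>_def by linarith+
    define A where "A = Re (u x) + Re (u y)"
    define B where "B = Im (u x) + Im (u y)"
    have "D = - A * (p x - p y) - (A * Re (r x - r y) + B * Im (r x - r y))"
      unfolding D_def A_def B_def cmod_power2 u_def by (simp add: power2_eq_square algebra_simps)
    moreover have AB: "\<bar>A\<bar> \<le> 4" "\<bar>B\<bar> \<le> 4"
      using ubd[OF xy(1)] ubd[OF xy(2)] abs_Re_le_cmod[of "u x"] abs_Re_le_cmod[of "u y"]
        abs_Im_le_cmod[of "u x"] abs_Im_le_cmod[of "u y"] unfolding A_def B_def by linarith+
    have "\<bar>A\<bar> * \<bar>Re (r x - r y)\<bar> \<le> 4 * (\<epsilon> * \<tau>)" "\<bar>B\<bar> * \<bar>Im (r x - r y)\<bar> \<le> 4 * (\<epsilon> * \<tau>)"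
      using AB Dr by (auto intro!: mult_mono simp del: minus_complex.sel)
    then have "\<bar>A * Re (r x - r y) + B * Im (r x - r y)\<bar> \<le> 8 * (\<epsilon> * \<tau>)"
      using abs_triangle_ineq[of "A * Re (r x - r y)" "B * Im (r x - r y)"] unfolding abs_mult by linarith
    moreover have "\<bar>- A * (p x - p y)\<bar> = \<bar>A\<bar> * \<tau>" unfolding \<tau>_def by (simp add: abs_mult)
    ultimately have "\<bar>A\<bar> * \<tau> - 8 * (\<epsilon> * \<tau>) \<le> \<bar>D\<bar>" by linarith
    \<comment> \<open>No cancellation occurs in \<open>A\<close>: both real parts have the sign
      \<open>\<sigma>\<close> and modulus at least \<open>q / 2\<close>.\<close>
    moreover have "\<bar>A\<bar> \<ge> q" using Rpos[OF xy(1)] Rpos[OF xy(2)] \<sigma> unfolding A_def by auto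
    then have "q * \<tau> \<le> \<bar>A\<bar> * \<tau>" by (intro mult_right_mono) (auto simp: \<tau>_def)
    ultimately have "q * \<tau> - 8 * (\<epsilon> * \<tau>) - 4 / E * \<tau> \<le> 2 / E * \<bar>p' x - p' y\<bar>"
      using D1 by linarith
    moreover have "q * \<tau> - 8 * (\<epsilon> * \<tau>) - 4 / E * \<tau> = (q - (8 * K + 4) / E) * \<tau>"
      unfolding \<epsilon>_def by (simp add: algebra_simps add_divide_distrib)
    moreover have "(q / 2) * \<tau> \<le> (q - (8 * K + 4) / E) * \<tau>"
      using E(4) by (intro mult_right_mono) (auto simp: \<tau>_def)
    ultimately have "(q / 2) * \<tau> \<le> 2 / E * \<bar>p' x - p' y\<bar>" by linarith
    then show ?thesis using q E15 unfolding \<tau>_def by (simp add: field_simps)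
  qed
  show dp2: "\<bar>p x - p y\<bar> \<le> \<bar>p' x - p' y\<bar> / 2" if xy: "x \<in> \<Omega>'" "y \<in> \<Omega>'" for x y
    using dp[OF xy] mult_right_mono[OF E(5), of "\<bar>p' x - p' y\<bar>"] by simp
  obtain \<xi> where \<xi>: "\<And>t. t \<in> {E - 3<..<E + 3} \<Longrightarrow> \<xi> t \<in> \<Omega> \<and> p (\<xi> t) = t"
    and cont: "continuous_on {E - 3<..<E + 3} (\<lambda>t. r (\<xi> t))"
    using controlled_inverse[OF ctl] E15 K by auto
  have surj: "\<exists>x\<in>\<Omega>'. p' x = s" if s: "E - 3 < s" "s < E + 3" for s
  proof -
    \<comment> \<open>With \<open>r\<close> replaced by \<open>c\<close>, the value
      \<open>t0\<close> of \<open>p\<close> gives \<open>Re u = \<sigma> * q\<close>. Within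
      \<open>q / 2\<close> of it \<open>Re u\<close> keeps its sign.\<close>
    define t0 where "t0 = E - Re c - \<sigma> * q"
    have c1: "\<bar>Re c\<bar> \<le> 1" using abs_Re_le_cmod[of c] c by linarith
    have T: "{t0 - q / 2..t0 + q / 2} \<subseteq> {E - 3<..<E + 3}"
      using c1 q1 q(1) \<sigma> unfolding t0_def by auto
    let ?g = "\<lambda>t. t * (cmod (complex_of_real E - \<i> * of_real \<gamma> - of_real t - r (\<xi> t)))\<^sup>2"
    have x: "\<xi> t \<in> \<Omega>" "p (\<xi> t) = t" "p' (\<xi> t) = ?g t" if "t \<in> {t0 - q / 2..t0 + q / 2}" for t
    proof -
      have "t \<in> {E - 3<..<E + 3}" using that T by blast
      then show "\<xi> t \<in> \<Omega>" "p (\<xi> t) = t" using \<xi> by auto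
      then show "p' (\<xi> t) = ?g t" unfolding p'_def u_def by simp
    qed
    have \<sigma>1: "\<sigma> * \<sigma> = 1" "\<bar>\<sigma>\<bar> = 1" using \<sigma> by auto
    have Re\<xi>: "\<bar>\<sigma> * Re (u (\<xi> t)) - (q - \<sigma> * (t - t0))\<bar> \<le> \<epsilon>" if "t \<in> {t0 - q / 2..t0 + q / 2}" for t
    proof -
      have "\<sigma> * Re (u (\<xi> t)) - (q - \<sigma> * (t - t0)) = - \<sigma> * Re (r (\<xi> t) - c)"
        unfolding Reu x(2)[OF that] t0_def using \<sigma> by auto
      then show ?thesis using Rer[OF x(1)[OF that]] \<sigma>1 by (simp add: abs_mult)
    qed
    have sgn: "\<sigma> * Re (u (\<xi> t)) > 0" if "t \<in> {t0 - q / 2..t0 + q / 2}" for t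
    proof -
      have "\<sigma> * (t - t0) \<le> q / 2" using that \<sigma> by auto
      then show ?thesis using Re\<xi>[OF that] \<epsilon>(4) by linarith
    qed
    \<comment> \<open>The summand \<open>24 / q^2\<close> in the bound on \<open>E\<close> makes the
      factors \<open>1 - q^2 / 4\<close> and \<open>1 + q^2 / 2\<close>, met at the two endpoints,
      carry every point of the window beyond its opposite end.\<close>
    have "24 + 3 * q\<^sup>2 \<le> E * q\<^sup>2"
      using E(1) q(1) by (simp add: field_simps)
    moreover have eqs: "(E - 3) * (q\<^sup>2 / 2) = (E * q\<^sup>2 - 3 * q\<^sup>2) / 2"
      and eqs': "(E + 3) * (q\<^sup>2 / 4) = (E * q\<^sup>2 + 3 * q\<^sup>2) / 4"
      by (simp_all add: algebra_simps)
    moreover have "6 \<le> (a - 3 * b) / 2 \<and> 6 \<le> (a + 3 * b) / 4" if "24 + 3 * b \<le> a" "0 \<le> b" for a b :: real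
      using that by auto
    ultimately have q6: "6 \<le> (E - 3) * (q\<^sup>2 / 2)" and q6': "6 \<le> (E + 3) * (q\<^sup>2 / 4)"
      using zero_le_power2[of q] unfolding eqs eqs' by blast+
    have norm2: "(cmod (u (\<xi> t)))\<^sup>2 = (\<sigma> * Re (u (\<xi> t)))\<^sup>2 + (Im (u (\<xi> t)))\<^sup>2" for t
      unfolding cmod_power2 using \<sigma> by auto
    have low: "?g (t0 + \<sigma> * (q / 2)) \<le> E - 3"
    proof -
      let ?t = "t0 + \<sigma> * (q / 2)"
      have t: "?t \<in> {t0 - q / 2..t0 + q / 2}" using \<sigma> q by auto
      have "\<sigma> * (?t - t0) = q / 2" using \<sigma> by auto
      then have "\<sigma> * Re (u (\<xi> ?t)) \<le> q / 2 + \<epsilon>" using Re\<xi>[OF t] by linarith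
      then have "(\<sigma> * Re (u (\<xi> ?t)))\<^sup>2 \<le> (q / 2 + \<epsilon>)\<^sup>2" using sgn[OF t] by (intro power_mono) auto
      also have "\<dots> = q\<^sup>2 / 4 + \<epsilon> * (q + \<epsilon>)" by (simp add: power2_eq_square algebra_simps)
      also have "\<dots> \<le> q\<^sup>2 / 4 + \<epsilon> * 2" using \<epsilon> q1 by (intro add_left_mono mult_left_mono) auto
      finally have "(cmod (u (\<xi> ?t)))\<^sup>2 \<le> q\<^sup>2 / 4 + \<epsilon> * 2 + (S\<^sup>2 + 3 * \<epsilon>)"
        using Im2[OF x(1)[OF t]] unfolding norm2 by linarith
      also have "\<dots> \<le> 1 - q\<^sup>2 / 4" using q(2) \<epsilon> by linarith
      finally have 1: "(cmod (u (\<xi> ?t)))\<^sup>2 \<le> 1 - q\<^sup>2 / 4" .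
      have "?g ?t \<le> (E + 3) * (1 - q\<^sup>2 / 4)"
        using px[OF x(1)[OF t]] 1 E15 unfolding x(3)[OF t,symmetric] p'_def by (intro mult_mono) auto
      also have "\<dots> \<le> E - 3" using q6' by (simp add: algebra_simps)
      finally show ?thesis .
    qed
    have high: "E + 3 \<le> ?g (t0 - \<sigma> * (q / 2))"
    proof -
      let ?t = "t0 - \<sigma> * (q / 2)"
      have t: "?t \<in> {t0 - q / 2..t0 + q / 2}" using \<sigma> q by auto
      have "\<sigma> * (?t - t0) = - (q / 2)" using \<sigma> by auto
      then have "3 * q / 2 - \<epsilon> \<le> \<sigma> * Re (u (\<xi> ?t))" using Re\<xi>[OF t] by linarith
      then have "(3 * q / 2 - \<epsilon>)\<^sup>2 \<le> (\<sigma> * Re (u (\<xi> ?t)))\<^sup>2" using q \<epsilon>(4) by (intro power_mono) auto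
      moreover have "(3 * q / 2 - \<epsilon>)\<^sup>2 = 9 * q\<^sup>2 / 4 - 3 * (\<epsilon> * q) + \<epsilon>\<^sup>2"
        by (simp add: power2_eq_square algebra_simps)
      moreover have "\<epsilon> * q \<le> \<epsilon>" "0 \<le> \<epsilon>\<^sup>2" using \<epsilon> q1 by (auto intro: mult_left_le)
      ultimately have "9 * q\<^sup>2 / 4 - \<epsilon> * 3 + (S\<^sup>2 - 3 * \<epsilon>) \<le> (cmod (u (\<xi> ?t)))\<^sup>2"
        using Im2[OF x(1)[OF t]] unfolding norm2 by linarith
      then have 1: "1 + q\<^sup>2 / 2 \<le> (cmod (u (\<xi> ?t)))\<^sup>2" using q(2) \<epsilon> by linarith
      have "E + 3 \<le> (E - 3) * (1 + q\<^sup>2 / 2)" using q6 by (simp add: algebra_simps)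
      also have "\<dots> \<le> ?g ?t"
        using px[OF x(1)[OF t]] 1 E15 unfolding x(3)[OF t,symmetric] p'_def by (intro mult_mono) auto
      finally show ?thesis .
    qed
    have contg: "continuous_on {t0 - q / 2..t0 + q / 2} ?g"
      by (intro continuous_intros continuous_on_subset[OF cont T])
    \<comment> \<open>For \<open>\<sigma> = 1\<close> the low value sits at the right endpoint, for
      \<open>\<sigma> = -1\<close> at the left one.\<close>
    have "\<exists>t\<in>{t0 - q / 2..t0 + q / 2}. ?g t = s"
    proof (cases "\<sigma> = 1")
      case True
      then show ?thesis
        using IVT2'[of ?g "t0 + q / 2" s "t0 - q / 2"] low high s q contg by fastforce
    next
      case False
      then show ?thesis
        using IVT'[of ?g "t0 - q / 2" s "t0 + q / 2"] \<sigma> low high s q contg by fastforce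
    qed
    then obtain t where t: "t \<in> {t0 - q / 2..t0 + q / 2}" "?g t = s" by blast
    then show ?thesis
      using x[OF t(1)] sgn[OF t(1)] s unfolding \<Omega>'_def by (intro bexI[of _ "\<xi> t"]) auto
  qed
  \<comment> \<open>A single constant must serve both clauses of \<open>controlled\<close>:
    \<open>2 * \<mu>\<close> covers the distance from the centre and \<open>32 / q\<close> the
    Lipschitz bound.\<close>
  have pos: "0 \<le> 2 * \<mu> / E" "0 \<le> 32 / q / E" using \<mu>E q E15 by auto
  show "controlled E (2 * \<mu> + 32 / q) (Complex (\<sigma> * q) S) {E - 3<..<E + 3} \<Omega>' p' (\<lambda>x. 1 / u x)"
    unfolding controlled_def
  proof (intro conjI ballI)
    show "p' ` \<Omega>' = {E - 3<..<E + 3}"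
      using surj unfolding \<Omega>'_def by (fastforce simp: image_iff)
  next
    fix x assume x: "x \<in> \<Omega>'"
    have "Complex (\<sigma> * q) S * w = 1"
      using q(2) \<sigma> unfolding w_def by (auto simp: complex_eq_iff power2_eq_square algebra_simps)
    then have "Complex (\<sigma> * q) S = 1 / w" using w by (metis eq_divide_eq mult_zero_right zero_neq_one)
    then have "cmod (1 / u x - Complex (\<sigma> * q) S) \<le> cmod (u x - w) / (1 / 2 * 1)"
      using cmod_inverse_diff[of "1 / 2" "u x" 1 w] ubd[OF x] w by simp
    also have "\<dots> \<le> (\<mu> / E) / (1 / 2 * 1)" using uw[OF x] by (intro divide_right_mono) auto
    also have "\<dots> = 2 * \<mu> / E" by simp
    also have "\<dots> \<le> 2 * \<mu> / E + 32 / q / E" using pos by linarith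
    also have "\<dots> = (2 * \<mu> + 32 / q) / E" by (simp only: add_divide_distrib)
    finally show "cmod (1 / u x - Complex (\<sigma> * q) S) \<le> (2 * \<mu> + 32 / q) / E" .
  next
    fix x y assume xy: "x \<in> \<Omega>'" "y \<in> \<Omega>'"
    show "\<bar>x - y\<bar> \<le> \<bar>p' x - p' y\<bar>"
      by (rule order_trans[OF inj[OF sub[OF xy(1)] sub[OF xy(2)]] order_trans[OF dp2[OF xy]]]) simp
    have "u x - u y = - of_real (p x - p y) - (r x - r y)" unfolding u_def by simp
    then have "cmod (u x - u y) \<le> \<bar>p x - p y\<bar> + cmod (r x - r y)"
      by (metis norm_minus_cancel norm_of_real norm_triangle_ineq4)
    also have "\<dots> \<le> \<bar>p x - p y\<bar> + 1 * \<bar>p x - p y\<bar>"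
      using lip[OF sub[OF xy(1)] sub[OF xy(2)]] mult_right_mono[of \<epsilon> 1 "\<bar>p x - p y\<bar>"] \<epsilon> by auto
    finally have du: "cmod (u x - u y) \<le> 2 * \<bar>p x - p y\<bar>" by simp
    have "cmod (1 / u x - 1 / u y) \<le> cmod (u x - u y) / (1 / 2 * (1 / 2))"
      using ubd xy by (intro cmod_inverse_diff) auto
    also have "\<dots> \<le> 8 * (4 / (q * E) * \<bar>p' x - p' y\<bar>)" using du dp[OF xy] by simp
    also have "\<dots> = 32 / q / E * \<bar>p' x - p' y\<bar>" by simp
    also have "\<dots> \<le> (2 * \<mu> + 32 / q) / E * \<bar>p' x - p' y\<bar>"
      using pos by (intro mult_right_mono) (auto simp: add_divide_distrib)
    finally show "cmod (1 / u x - 1 / u y) \<le> (2 * \<mu> + 32 / q) / E * \<bar>p' x - p' y\<bar>" .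
  qed
qed

subsection \<open>Smooth functions of one real variable\<close>

text \<open>The derivative is an arbitrary witness, so closure proofs can supply a formula instead
  of computing with \<open>vector_derivative\<close>. The finite order allows induction on
  \<open>k\<close>.\<close>

primrec times_differentiable_on :: "nat \<Rightarrow> real set \<Rightarrow> (real \<Rightarrow> 'a::real_normed_vector) \<Rightarrow> bool" where
  "times_differentiable_on 0 S f \<longleftrightarrow> True"
| "times_differentiable_on (Suc k) S f \<longleftrightarrow>
     (\<exists>f'. (\<forall>t\<in>S. (f has_vector_derivative f' t) (at t)) \<and> times_differentiable_on k S f')"

lemma times_differentiable_on_SucI:
  assumes "times_differentiable_on k S f'" "\<And>t. t \<in> S \<Longrightarrow> (f has_vector_derivative f' t) (at t)"
  shows "times_differentiable_on (Suc k) S f"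
  using assms by auto

lemma times_differentiable_on_cong:
  assumes "open S" "\<And>t. t \<in> S \<Longrightarrow> f t = g t" "times_differentiable_on k S f"
  shows "times_differentiable_on k S g"
proof (cases k)
  case (Suc m)
  then show ?thesis
    using assms has_vector_derivative_transform_within_open[where S = S and f = f and g = g]
    by (auto, blast)
qed simp

lemma times_differentiable_on_Suc_D:
  "times_differentiable_on (Suc k) S f \<Longrightarrow> times_differentiable_on k S f"
  by (induction k arbitrary: f) (simp, metis times_differentiable_on.simps(2))

text \<open>By uniqueness of derivatives the witnesses agree with \<open>vector_derivative\<close>
  on \<open>S\<close>, and openness of \<open>S\<close> passes this agreement on to the higher
  derivatives.\<close>

lemma C_infinity_on_if_times_differentiable_on:
  assumes S: "open S" and f: "\<And>k. times_differentiable_on k S f"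
  shows "C_infinity_on S f"
proof -
  have step: "times_differentiable_on k S (\<lambda>t. vector_derivative g (at t))"
    if "times_differentiable_on (Suc k) S g" for k and g :: "real \<Rightarrow> 'a"
  proof -
    obtain g' where g': "\<And>t. t \<in> S \<Longrightarrow> (g has_vector_derivative g' t) (at t)"
        "times_differentiable_on k S g'"
      using \<open>times_differentiable_on (Suc k) S g\<close> by auto
    then show ?thesis
      using times_differentiable_on_cong[OF S, of g' "\<lambda>t. vector_derivative g (at t)" k]
        vector_derivative_at by metis
  qed
  have "times_differentiable_on (Suc k) S g \<Longrightarrow>
      \<forall>t\<in>S. nth_vector_derivative k g differentiable (at t)" for k and g :: "real \<Rightarrow> 'a"
  proof (induction k arbitrary: g)
    case 0
    then show ?case
      by (auto simp: nth_vector_derivative_def intro: differentiableI_vector)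
  next
    case (Suc k)
    then have "\<forall>t\<in>S. nth_vector_derivative k (\<lambda>t. vector_derivative g (at t)) differentiable (at t)"
      using step by blast
    then show ?case
      by (simp add: nth_vector_derivative_def funpow_Suc_right del: funpow.simps)
  qed
  then show ?thesis
    using f unfolding C_infinity_on_def by blast
qed

lemma times_differentiable_on_const: "times_differentiable_on k S (\<lambda>_. c)"
proof (induction k arbitrary: c)
  case (Suc k)
  then show ?case by (auto intro!: exI[of _ "\<lambda>_. 0"])
qed simp

lemma times_differentiable_on_ident: "times_differentiable_on k S (\<lambda>t. t)"
proof (cases k)
  case (Suc m)
  then show ?thesis
    using times_differentiable_on_const[of m S 1] by (auto intro!: exI[of _ "\<lambda>_. 1"] derivative_eq_intros)
qed simp

lemma times_differentiable_on_add:
  "times_differentiable_on k S f \<Longrightarrow> times_differentiable_on k S g \<Longrightarrow>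
     times_differentiable_on k S (\<lambda>t. f t + g t)"
proof (induction k arbitrary: f g)
  case (Suc k)
  from Suc.prems obtain f' g' where "\<And>t. t \<in> S \<Longrightarrow> (f has_vector_derivative f' t) (at t)"
      "\<And>t. t \<in> S \<Longrightarrow> (g has_vector_derivative g' t) (at t)"
      "times_differentiable_on k S f'" "times_differentiable_on k S g'"
    unfolding times_differentiable_on.simps by blast
  then show ?case
    using Suc.IH[of f' g'] by (auto intro!: exI[of _ "\<lambda>t. f' t + g' t"] has_vector_derivative_add)
qed simp

lemma times_differentiable_on_bounded_linear:
  assumes "bounded_linear L"
  shows "times_differentiable_on k S f \<Longrightarrow> times_differentiable_on k S (\<lambda>t. L (f t))"
proof (induction k arbitrary: f)
  case (Suc k)
  from Suc.prems obtain f' where "\<And>t. t \<in> S \<Longrightarrow> (f has_vector_derivative f' t) (at t)"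
      "times_differentiable_on k S f'"
    unfolding times_differentiable_on.simps by blast
  then show ?case
    using Suc.IH[of f'] bounded_linear.has_vector_derivative[OF assms]
    by (auto intro!: exI[of _ "\<lambda>t. L (f' t)"])
qed simp

lemma times_differentiable_on_mult:
  fixes f g :: "real \<Rightarrow> 'a::real_normed_algebra"
  shows "times_differentiable_on k S f \<Longrightarrow> times_differentiable_on k S g \<Longrightarrow>
     times_differentiable_on k S (\<lambda>t. f t * g t)"
proof (induction k arbitrary: f g)
  case (Suc k)
  from Suc.prems obtain f' g' where "\<And>t. t \<in> S \<Longrightarrow> (f has_vector_derivative f' t) (at t)"
      "\<And>t. t \<in> S \<Longrightarrow> (g has_vector_derivative g' t) (at t)"
      and k: "times_differentiable_on k S f'" "times_differentiable_on k S g'"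
    unfolding times_differentiable_on.simps by blast
  moreover have "times_differentiable_on k S (\<lambda>t. f t * g' t + f' t * g t)"
    using k Suc times_differentiable_on_Suc_D by (intro times_differentiable_on_add) blast+
  ultimately show ?case
    by (auto intro!: exI[of _ "\<lambda>t. f t * g' t + f' t * g t"] has_vector_derivative_mult)
qed simp

text \<open>The derivative is a product of \<open>f'\<close> and two copies of
  \<open>inverse f\<close>, so the induction hypothesis on \<open>inverse f\<close> itself yields
  the next order.\<close>

lemma times_differentiable_on_inverse:
  fixes f :: "real \<Rightarrow> real"
  assumes nz: "\<And>t. t \<in> S \<Longrightarrow> f t \<noteq> 0"
  shows "times_differentiable_on k S f \<Longrightarrow> times_differentiable_on k S (\<lambda>t. inverse (f t))"
proof (induction k)
  case (Suc k)
  from Suc.prems obtain f' where f': "\<And>t. t \<in> S \<Longrightarrow> (f has_vector_derivative f' t) (at t)"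
      "times_differentiable_on k S f'"
    unfolding times_differentiable_on.simps by blast
  have inv: "times_differentiable_on k S (\<lambda>t. inverse (f t))"
    using Suc times_differentiable_on_Suc_D by blast
  have "times_differentiable_on k S (\<lambda>t. - 1 * (inverse (f t) * f' t * inverse (f t)))"
    by (intro times_differentiable_on_mult times_differentiable_on_const inv f')
  moreover have "((\<lambda>t. inverse (f t)) has_vector_derivative - 1 * (inverse (f t) * f' t * inverse (f t))) (at t)"
    if "t \<in> S" for t
    using DERIV_inverse'[of f "f' t" t UNIV] f'(1)[OF that] nz[OF that]
    by (simp add: has_real_derivative_iff_has_vector_derivative)
  ultimately show ?case
    by (rule times_differentiable_on_SucI)
qed simp

text \<open>The inverse root is treated rather than the root because its derivative is a product of
  \<open>f'\<close> and powers of the function itself; no quotient rule is needed.\<close>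

lemma times_differentiable_on_inverse_sqrt:
  fixes f :: "real \<Rightarrow> real"
  assumes pos: "\<And>t. t \<in> S \<Longrightarrow> f t > 0"
  shows "times_differentiable_on k S f \<Longrightarrow> times_differentiable_on k S (\<lambda>t. inverse (sqrt (f t)))"
proof (induction k)
  case (Suc k)
  from Suc.prems obtain f' where f': "\<And>t. t \<in> S \<Longrightarrow> (f has_vector_derivative f' t) (at t)"
      "times_differentiable_on k S f'"
    unfolding times_differentiable_on.simps by blast
  let ?g = "\<lambda>t. inverse (sqrt (f t))"
  have inv: "times_differentiable_on k S ?g"
    using Suc times_differentiable_on_Suc_D by blast
  have "times_differentiable_on k S (\<lambda>t. - (1 / 2) * (f' t * (?g t * (?g t * ?g t))))"
    by (intro times_differentiable_on_mult times_differentiable_on_const inv f')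
  moreover have "(?g has_vector_derivative - (1 / 2) * (f' t * (?g t * (?g t * ?g t)))) (at t)"
    if "t \<in> S" for t
  proof -
    have "(f has_real_derivative f' t) (at t)"
      using f'(1)[OF that] by (simp add: has_real_derivative_iff_has_vector_derivative)
    then have "(?g has_real_derivative - (1 / 2) * (f' t * (?g t * (?g t * ?g t)))) (at t)"
      using pos[OF that] by (auto intro!: derivative_eq_intros simp: field_simps)
    then show ?thesis
      by (simp add: has_real_derivative_iff_has_vector_derivative)
  qed
  ultimately show ?case
    by (rule times_differentiable_on_SucI)
qed simp

text \<open>Closing under conjugation makes the class contain \<open>|F|\<^sup>2\<close> along with \<open>F\<close>.\<close>

inductive conj_polynomial :: "(real \<Rightarrow> real \<Rightarrow> complex) \<Rightarrow> bool" where
  const: "conj_polynomial (\<lambda>x E. c)"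
| fst: "conj_polynomial (\<lambda>x E. of_real x)"
| snd: "conj_polynomial (\<lambda>x E. of_real E)"
| add: "conj_polynomial F \<Longrightarrow> conj_polynomial G \<Longrightarrow> conj_polynomial (\<lambda>x E. F x E + G x E)"
| mult: "conj_polynomial F \<Longrightarrow> conj_polynomial G \<Longrightarrow> conj_polynomial (\<lambda>x E. F x E * G x E)"
| cnj: "conj_polynomial F \<Longrightarrow> conj_polynomial (\<lambda>x E. cnj (F x E))"

lemma conj_polynomial_diff:
  assumes "conj_polynomial F" "conj_polynomial G"
  shows "conj_polynomial (\<lambda>x E. F x E - G x E)"
  using conj_polynomial.add[OF assms(1) conj_polynomial.mult[OF conj_polynomial.const[of "-1"] assms(2)]]
  by simp

lemma times_differentiable_on_conj_polynomial:
  assumes "times_differentiable_on k S \<xi>" "conj_polynomial F"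
  shows "times_differentiable_on k S (\<lambda>E. F (\<xi> E) E)"
  using assms(2)
  by induction (auto intro: times_differentiable_on_const times_differentiable_on_add times_differentiable_on_mult
      assms(1) times_differentiable_on_ident times_differentiable_on_bounded_linear bounded_linear_of_real bounded_linear_cnj)

lemma conj_polynomial_continuous:
  assumes "conj_polynomial F"
  shows "continuous_on A (\<lambda>p. F (fst p) (snd p))"
  using assms by induction (auto intro!: continuous_intros)

text \<open>That the partial derivatives stay in the class lets the implicit function argument be
  iterated. Conjugation is harmless since both variables are real.\<close>

lemma conj_polynomial_partials:
  assumes "conj_polynomial F"
  shows "\<exists>Fx Fe. conj_polynomial Fx \<and> conj_polynomial Fe \<and>
     (\<forall>q. ((\<lambda>p. F (fst p) (snd p)) has_derivative
        (\<lambda>h. of_real (fst h) * Fx (fst q) (snd q) + of_real (snd h) * Fe (fst q) (snd q))) (at q))"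
  using assms
proof induction
  case (const c)
  show ?case
    by (intro exI[of _ "\<lambda>_ _. 0"] conjI conj_polynomial.const allI) (auto intro!: derivative_eq_intros)
next
  case fst
  show ?case
    by (intro exI[of _ "\<lambda>_ _. 1"] exI[of _ "\<lambda>_ _. 0"] conjI conj_polynomial.const allI)
      (auto intro!: derivative_eq_intros)
next
  case snd
  show ?case
    by (intro exI[of _ "\<lambda>_ _. 0"] exI[of _ "\<lambda>_ _. 1"] conjI conj_polynomial.const allI)
      (auto intro!: derivative_eq_intros)
next
  case (add F G)
  then obtain Fx Fe Gx Ge where *: "conj_polynomial Fx" "conj_polynomial Fe" "conj_polynomial Gx" "conj_polynomial Ge"
    "\<And>q. ((\<lambda>p. F (fst p) (snd p)) has_derivative
        (\<lambda>h. of_real (fst h) * Fx (fst q) (snd q) + of_real (snd h) * Fe (fst q) (snd q))) (at q)"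
    "\<And>q. ((\<lambda>p. G (fst p) (snd p)) has_derivative
        (\<lambda>h. of_real (fst h) * Gx (fst q) (snd q) + of_real (snd h) * Ge (fst q) (snd q))) (at q)"
    by blast
  show ?case
    by (intro exI[of _ "\<lambda>x E. Fx x E + Gx x E"] exI[of _ "\<lambda>x E. Fe x E + Ge x E"] conjI conj_polynomial.add allI *
        has_derivative_eq_rhs[OF has_derivative_add[OF *(5,6)]])
      (auto simp: algebra_simps)
next
  case (mult F G)
  then obtain Fx Fe Gx Ge where *: "conj_polynomial Fx" "conj_polynomial Fe" "conj_polynomial Gx" "conj_polynomial Ge"
    "\<And>q. ((\<lambda>p. F (fst p) (snd p)) has_derivative
        (\<lambda>h. of_real (fst h) * Fx (fst q) (snd q) + of_real (snd h) * Fe (fst q) (snd q))) (at q)"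
    "\<And>q. ((\<lambda>p. G (fst p) (snd p)) has_derivative
        (\<lambda>h. of_real (fst h) * Gx (fst q) (snd q) + of_real (snd h) * Ge (fst q) (snd q))) (at q)"
    by blast
  show ?case
    by (intro exI[of _ "\<lambda>x E. F x E * Gx x E + Fx x E * G x E"] exI[of _ "\<lambda>x E. F x E * Ge x E + Fe x E * G x E"]
        conjI conj_polynomial.add conj_polynomial.mult allI * mult.hyps
        has_derivative_eq_rhs[OF has_derivative_mult[OF *(5,6)]])
      (auto simp: algebra_simps)
next
  case (cnj F)
  then obtain Fx Fe where *: "conj_polynomial Fx" "conj_polynomial Fe"
    "\<And>q. ((\<lambda>p. F (fst p) (snd p)) has_derivative
        (\<lambda>h. of_real (fst h) * Fx (fst q) (snd q) + of_real (snd h) * Fe (fst q) (snd q))) (at q)"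
    by blast
  show ?case
    by (intro exI[of _ "\<lambda>x E. cnj (Fx x E)"] exI[of _ "\<lambda>x E. cnj (Fe x E)"] conjI conj_polynomial.cnj allI *(1,2)
        has_derivative_eq_rhs[OF bounded_linear.has_derivative[OF bounded_linear_cnj *(3)]])
      auto
qed

subsection \<open>A one-variable implicit function theorem\<close>

text \<open>The lower bound on difference quotients replaces the usual hypotheses: it yields uniqueness,
  continuity of the root, and a nonzero partial derivative all at once.\<close>

lemma implicit_function_has_derivative:
  fixes f :: "real \<times> real \<Rightarrow> real" and A B :: real
  assumes D: "open D" and S: "open S" "t \<in> S"
    and root: "\<And>s. s \<in> S \<Longrightarrow> (\<xi> s, s) \<in> D \<and> f (\<xi> s, s) = 0"
    and inj: "\<And>x y s. (x, s) \<in> D \<Longrightarrow> (y, s) \<in> D \<Longrightarrow> \<bar>x - y\<bar> \<le> 2 * \<bar>f (x, s) - f (y, s)\<bar>"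
    and f: "(f has_derivative (\<lambda>h. fst h * A + snd h * B)) (at (\<xi> t, t))"
  shows "A \<noteq> 0" and "(\<xi> has_real_derivative - B / A) (at t)"
proof -
  define x where "x = \<xi> t"
  have fx: "f (x, t) = 0" and xD: "(x, t) \<in> D" using root S unfolding x_def by auto
  note f = f[folded x_def]
  have evD1: "\<forall>\<^sub>F y in at x. (y, t) \<in> D"
    by (rule topological_tendstoD[OF _ D xD]) (intro tendsto_intros)
  have evD2: "\<forall>\<^sub>F s in at t. (x, s) \<in> D"
    by (rule topological_tendstoD[OF _ D xD]) (intro tendsto_intros)
  have evx: "\<forall>\<^sub>F y in at x. y \<noteq> x" and evt: "\<forall>\<^sub>F s in at t. s \<noteq> t"
    by (rule eventually_neq_at_within)+
  have evS: "\<forall>\<^sub>F s in at t. s \<in> S"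
    using eventually_at_in_open' S by blast
  have "((\<lambda>y. (y, t)) has_derivative (\<lambda>h. (h, 0))) (at x)"
    by (auto intro!: derivative_eq_intros)
  from has_derivative_compose[OF this f]
  have "((\<lambda>y. f (y, t)) has_real_derivative A) (at x)"
    by (rule has_derivative_imp_has_field_derivative) simp
  then have "((\<lambda>y. \<bar>(f (y, t) - f (x, t)) / (y - x)\<bar>) \<longlongrightarrow> \<bar>A\<bar>) (at x)"
    unfolding has_field_derivative_iff by (intro tendsto_intros)
  \<comment> \<open>At fixed \<open>t\<close> the hypothesis \<open>inj\<close> bounds all
    difference quotients in the first variable below by \<open>1 / 2\<close>, and the limit
    \<open>A\<close> inherits this.\<close>
  moreover have "\<forall>\<^sub>F y in at x. 1 / 2 \<le> \<bar>(f (y, t) - f (x, t)) / (y - x)\<bar>"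
    using evD1 evx
  proof eventually_elim
    case (elim y)
    then show ?case using inj[of y t x] xD by (simp add: abs_divide field_simps)
  qed
  ultimately have "1 / 2 \<le> \<bar>A\<bar>"
    using tendsto_lowerbound trivial_limit_at by blast
  then show A: "A \<noteq> 0" by auto
  have "((\<lambda>s. (x, s)) has_derivative (\<lambda>h. (0, h))) (at t)"
    by (auto intro!: derivative_eq_intros)
  from has_derivative_compose[OF this f]
  have "((\<lambda>s. f (x, s)) has_real_derivative B) (at t)"
    by (rule has_derivative_imp_has_field_derivative) simp
  then have "((\<lambda>s. \<bar>(f (x, s) - f (x, t)) / (s - t)\<bar>) \<longlongrightarrow> \<bar>B\<bar>) (at t)"
    unfolding has_field_derivative_iff by (intro tendsto_intros)
  then have "\<forall>\<^sub>F s in at t. \<bar>(f (x, s) - f (x, t)) / (s - t)\<bar> < \<bar>B\<bar> + 1"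
    by (rule order_tendstoD) simp
  \<comment> \<open>Comparison of \<open>x\<close> and \<open>\<xi> s\<close> at the same parameter
    \<open>s\<close>: \<open>f\<close> vanishes at the second and is of order \<open>|s - t|\<close>
    at the first.\<close>
  then have lip: "\<forall>\<^sub>F s in at t. \<bar>\<xi> s - x\<bar> \<le> 2 * (\<bar>B\<bar> + 1) * \<bar>s - t\<bar>"
    using evD2 evS evt
  proof eventually_elim
    case (elim s)
    then have "\<bar>x - \<xi> s\<bar> \<le> 2 * \<bar>f (x, s)\<bar>" using inj[of x s "\<xi> s"] root[of s] by auto
    moreover have "\<bar>f (x, s)\<bar> \<le> (\<bar>B\<bar> + 1) * \<bar>s - t\<bar>"
      using elim fx by (simp add: abs_divide pos_divide_less_eq)
    ultimately have "\<bar>x - \<xi> s\<bar> \<le> 2 * ((\<bar>B\<bar> + 1) * \<bar>s - t\<bar>)" by linarith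
    then show ?case by (simp add: abs_minus_commute algebra_simps)
  qed
  have "((\<lambda>s. \<xi> s - x) \<longlongrightarrow> 0) (at t)"
  proof (rule Lim_null_comparison)
    show "\<forall>\<^sub>F s in at t. norm (\<xi> s - x) \<le> 2 * (\<bar>B\<bar> + 1) * \<bar>s - t\<bar>" using lip by simp
    have "((\<lambda>s. 2 * (\<bar>B\<bar> + 1) * \<bar>s - t\<bar>) \<longlongrightarrow> 2 * (\<bar>B\<bar> + 1) * \<bar>t - t\<bar>) (at t)"
      by (intro tendsto_intros)
    then show "((\<lambda>s. 2 * (\<bar>B\<bar> + 1) * \<bar>s - t\<bar>) \<longlongrightarrow> 0) (at t)" by simp
  qed
  then have "(\<xi> \<longlongrightarrow> x) (at t)" by (simp add: LIM_zero_iff)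
  then have "filterlim (\<lambda>s. (\<xi> s, s)) (at (x, t)) (at t)"
    unfolding filterlim_at by (auto intro!: tendsto_intros simp: eventually_at_filter)
  moreover have "((\<lambda>p. norm (f p - f (x, t) - (fst (p - (x, t)) * A + snd (p - (x, t)) * B)) / norm (p - (x, t))) \<longlongrightarrow> 0) (at (x, t))"
    using f unfolding has_derivative_iff_norm by blast
  ultimately have "((\<lambda>s. norm (f (\<xi> s, s) - f (x, t) - (fst ((\<xi> s, s) - (x, t)) * A + snd ((\<xi> s, s) - (x, t)) * B)) / norm ((\<xi> s, s) - (x, t))) \<longlongrightarrow> 0) (at t)"
    by (rule filterlim_compose[rotated])
  then have "((\<lambda>s. (2 * (\<bar>B\<bar> + 1) + 1) * (norm (f (\<xi> s, s) - f (x, t) - (fst ((\<xi> s, s) - (x, t)) * A + snd ((\<xi> s, s) - (x, t)) * B)) / norm ((\<xi> s, s) - (x, t)))) \<longlongrightarrow> 0) (at t)"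
    by (rule tendsto_mult_right_zero)
  \<comment> \<open>\<open>f\<close> vanishes at both points, so the numerator is just the linear
    part. Division by \<open>|s - t|\<close> instead of the norm costs the factor from
    \<open>lip\<close>.\<close>
  moreover have "\<forall>\<^sub>F s in at t. norm ((\<xi> s - x) / (s - t) * A + B) \<le> (2 * (\<bar>B\<bar> + 1) + 1) * (norm (f (\<xi> s, s) - f (x, t) - (fst ((\<xi> s, s) - (x, t)) * A + snd ((\<xi> s, s) - (x, t)) * B)) / norm ((\<xi> s, s) - (x, t)))"
    using lip evS evt
  proof eventually_elim
    case (elim s)
    have n: "norm ((\<xi> s, s) - (x, t)) \<le> (2 * (\<bar>B\<bar> + 1) + 1) * \<bar>s - t\<bar>"
      using elim norm_Pair_le[of "\<xi> s - x" "s - t"] by (simp add: algebra_simps)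
    have pos: "\<bar>s - t\<bar> > 0" "norm ((\<xi> s, s) - (x, t)) > 0" using elim by (auto simp: zero_prod_def)
    define X where "X = \<bar>(\<xi> s - x) * A + (s - t) * B\<bar>"
    have "norm ((\<xi> s - x) / (s - t) * A + B) = X / \<bar>s - t\<bar>"
      unfolding X_def real_norm_def abs_divide[symmetric] using elim by (simp add: field_simps)
    also have "\<dots> \<le> (2 * (\<bar>B\<bar> + 1) + 1) * (X / norm ((\<xi> s, s) - (x, t)))"
      using mult_left_mono[OF n, of X] pos by (simp add: X_def field_simps)
    also have "X = norm (f (\<xi> s, s) - f (x, t) - (fst ((\<xi> s, s) - (x, t)) * A + snd ((\<xi> s, s) - (x, t)) * B))"
      using root[of s] elim fx unfolding X_def by simp
    finally show ?case .
  qed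
  ultimately have "((\<lambda>s. (\<xi> s - x) / (s - t) * A + B) \<longlongrightarrow> 0) (at t)"
    by (rule Lim_null_comparison[rotated])
  then have "((\<lambda>s. ((\<xi> s - x) / (s - t) * A + B - B) / A) \<longlongrightarrow> (0 - B) / A) (at t)"
    using A by (intro tendsto_intros)
  then show "(\<xi> has_real_derivative - B / A) (at t)"
    unfolding has_field_derivative_iff x_def using A by simp
qed

text \<open>Bootstrapping: the derivative of \<open>\<xi>\<close> is a quotient of conjugate
  polynomials evaluated along \<open>\<xi>\<close>, so each order of differentiability of
  \<open>\<xi>\<close> yields the next.\<close>

lemma implicit_function_times_differentiable_on:
  assumes F: "conj_polynomial F" and D: "open D" and S: "open S"
    and root: "\<And>s. s \<in> S \<Longrightarrow> (\<xi> s, s) \<in> D \<and> Re (F (\<xi> s) s) = 0"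
    and inj: "\<And>x y s. (x, s) \<in> D \<Longrightarrow> (y, s) \<in> D \<Longrightarrow> \<bar>x - y\<bar> \<le> 2 * \<bar>Re (F x s) - Re (F y s)\<bar>"
  shows "times_differentiable_on k S \<xi>"
proof -
  obtain Fx Fe where poly: "conj_polynomial Fx" "conj_polynomial Fe"
    and F': "\<And>q. ((\<lambda>p. F (fst p) (snd p)) has_derivative
        (\<lambda>h. of_real (fst h) * Fx (fst q) (snd q) + of_real (snd h) * Fe (fst q) (snd q))) (at q)"
    using conj_polynomial_partials[OF F] by blast
  let ?f = "\<lambda>p. Re (F (fst p) (snd p))"
  have f: "(?f has_derivative
      (\<lambda>h. fst h * Re (Fx (\<xi> s) s) + snd h * Re (Fe (\<xi> s) s))) (at (\<xi> s, s))" for s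
    using has_derivative_Re[OF F'[of "(\<xi> s, s)"]] by simp
  have nz: "Re (Fx (\<xi> s) s) \<noteq> 0"
    and der: "(\<xi> has_real_derivative - Re (Fe (\<xi> s) s) / Re (Fx (\<xi> s) s)) (at s)" if "s \<in> S" for s
    using implicit_function_has_derivative[OF D S that, of \<xi> ?f, OF _ _ f] root inj by auto
  show ?thesis
  proof (induction k)
    case (Suc k)
    have "times_differentiable_on k S
        (\<lambda>s. - 1 * (Re (Fe (\<xi> s) s) * inverse (Re (Fx (\<xi> s) s))))"
      by (intro times_differentiable_on_mult times_differentiable_on_const times_differentiable_on_inverse nz
          times_differentiable_on_bounded_linear[OF bounded_linear_Re]
          times_differentiable_on_conj_polynomial Suc poly)
    then show ?case
      by (rule times_differentiable_on_SucI)
        (use der in \<open>auto simp: has_real_derivative_iff_has_vector_derivative divide_inverse\<close>)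
  qed simp
qed

lemma controlled_cong:
  assumes "controlled E K c I \<Omega> p r" "\<Omega> = \<Omega>'"
    "\<And>x. x \<in> \<Omega> \<Longrightarrow> p x = p' x" "\<And>x. x \<in> \<Omega> \<Longrightarrow> r x = r' x"
  shows "controlled E K c I \<Omega>' p' r'"
  using assms unfolding controlled_def by auto

subsection \<open>Shooting from the last site\<close>

text \<open>Sites are counted from the end: \<open>shoot g k\<close> is \<open>w\<^sub>n / w\<^sub>N\<close> for \<open>n = N - k\<close>, with \<open>g k = \<gamma>\<^sub>N\<^sub>-\<^sub>k\<close> and \<open>x = |w\<^sub>N|\<^sup>2\<close>.\<close>

fun shoot :: "(nat \<Rightarrow> real) \<Rightarrow> nat \<Rightarrow> real \<Rightarrow> real \<Rightarrow> complex" where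
  "shoot g 0 x E = 1"
| "shoot g (Suc 0) x E = of_real E - \<i> * of_real (g 0) - of_real x"
| "shoot g (Suc (Suc k)) x E =
     (of_real E - \<i> * of_real (g (Suc k)) - of_real (x * (cmod (shoot g (Suc k) x E))\<^sup>2)) * shoot g (Suc k) x E
     - shoot g k x E"

definition power_at :: "(nat \<Rightarrow> real) \<Rightarrow> real \<Rightarrow> nat \<Rightarrow> real \<Rightarrow> real" where
  "power_at g E k x = x * (cmod (shoot g k x E))\<^sup>2"

text \<open>This is the quotient of the amplitudes at sites \<open>N - k + 1\<close> and
  \<open>N - k\<close>; the value 0 at \<open>k = 0\<close> encodes the boundary condition beyond
  site \<open>N\<close>.\<close>

definition ratio_at :: "(nat \<Rightarrow> real) \<Rightarrow> real \<Rightarrow> nat \<Rightarrow> real \<Rightarrow> complex" where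
  "ratio_at g E k x = (if k = 0 then 0 else shoot g (k - 1) x E / shoot g k x E)"

text \<open>This matches \<open>shoot\<close> with the \<open>p\<close>, \<open>r\<close>,
  \<open>u\<close> of the one-step lemmas. The sign of \<open>Re u\<close> is tested on a product
  with a conjugate, which is \<open>u\<close> times a positive number and continuous
  everywhere.\<close>

lemma shoot_Suc:
  assumes "power_at g E k x > 0"
  defines "u \<equiv> of_real E - \<i> * of_real (g k) - of_real (power_at g E k x) - ratio_at g E k x"
  shows "shoot g (Suc k) x E = u * shoot g k x E"
    and "power_at g E (Suc k) x = power_at g E k x * (cmod u)\<^sup>2"
    and "ratio_at g E (Suc k) x = 1 / u"
    and "s * Re (shoot g (Suc k) x E * cnj (shoot g k x E)) > 0 \<longleftrightarrow> s * Re u > 0"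
proof -
  have nz: "shoot g k x E \<noteq> 0" using assms(1) unfolding power_at_def by auto
  show 1: "shoot g (Suc k) x E = u * shoot g k x E"
  proof (cases k)
    case (Suc m)
    then show ?thesis using nz by (simp add: u_def power_at_def ratio_at_def algebra_simps)
  qed (simp add: u_def power_at_def ratio_at_def)
  then show "power_at g E (Suc k) x = power_at g E k x * (cmod u)\<^sup>2"
    by (simp add: power_at_def norm_mult power_mult_distrib)
  show "ratio_at g E (Suc k) x = 1 / u"
    using nz by (simp add: ratio_at_def 1)
  have "shoot g (Suc k) x E * cnj (shoot g k x E) = of_real ((cmod (shoot g k x E))\<^sup>2) * u"
    unfolding 1 complex_norm_square by (simp add: mult_ac)
  then have eq: "s * Re (shoot g (Suc k) x E * cnj (shoot g k x E)) = (cmod (shoot g k x E))\<^sup>2 * (s * Re u)"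
    by (simp only: Re_complex_of_real times_complex.sel Im_complex_of_real) simp
  then show "s * Re (shoot g (Suc k) x E * cnj (shoot g k x E)) > 0 \<longleftrightarrow> s * Re u > 0"
    unfolding eq using nz by (simp add: zero_less_mult_iff)
qed

lemma conj_polynomial_shoot: "conj_polynomial (shoot g k)"
proof -
  have const': "conj_polynomial (\<lambda>x E. \<i> * of_real a)" for a by (rule conj_polynomial.const)
  have "conj_polynomial (shoot g k) \<and> conj_polynomial (shoot g (Suc k))"
  proof (induction k)
    case 0
    have "conj_polynomial (\<lambda>x E. of_real E - \<i> * of_real (g 0) - of_real x)"
      by (intro conj_polynomial_diff conj_polynomial.intros const')
    moreover have "shoot g 0 = (\<lambda>x E. 1)" "shoot g (Suc 0) = (\<lambda>x E. of_real E - \<i> * of_real (g 0) - of_real x)"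
      by (intro ext; simp)+
    ultimately show ?case using conj_polynomial.const by simp
  next
    case (Suc k)
    then have "conj_polynomial (\<lambda>x E. (of_real E - \<i> * of_real (g (Suc k))
        - of_real x * (shoot g (Suc k) x E * cnj (shoot g (Suc k) x E))) * shoot g (Suc k) x E - shoot g k x E)"
      by (intro conj_polynomial_diff conj_polynomial.intros const') auto
    moreover have "shoot g (Suc (Suc k)) = (\<lambda>x E. (of_real E - \<i> * of_real (g (Suc k))
        - of_real x * (shoot g (Suc k) x E * cnj (shoot g (Suc k) x E))) * shoot g (Suc k) x E - shoot g k x E)"
      by (intro ext) (simp add: complex_norm_square[symmetric])
    ultimately show ?case using Suc by simp
  qed
  then show ?thesis by blast
qed

text \<open>The first \<open>d = N - M\<close> levels form the tail; \<open>s j\<close> prescribes the sign of \<open>Re (w\<^sub>n\<^sub>-\<^sub>1 / w\<^sub>n)\<close> for \<open>n = N - j\<close>.\<close>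

definition region :: "(nat \<Rightarrow> real) \<Rightarrow> nat \<Rightarrow> (nat \<Rightarrow> real) \<Rightarrow> nat \<Rightarrow> real \<Rightarrow> real set" where
  "region g d s k E =
     {x. (\<forall>j\<le>k. power_at g E j x \<in> (if j < d then {0<..<1} else {E - 3<..<E + 3})) \<and>
         (\<forall>j\<in>{d..<k}. s j * Re (shoot g (Suc j) x E * cnj (shoot g j x E)) > 0)}"

lemma region_Suc:
  "region g d s (Suc k) E =
     {x \<in> region g d s k E. power_at g E (Suc k) x \<in> (if Suc k < d then {0<..<1} else {E - 3<..<E + 3})
        \<and> (d \<le> k \<longrightarrow> s k * Re (shoot g (Suc k) x E * cnj (shoot g k x E)) > 0)}"
  unfolding region_def by (auto simp: le_Suc_eq less_Suc_eq)

lemma region_mono: "j \<le> k \<Longrightarrow> region g d s k E \<subseteq> region g d s j E"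
  unfolding region_def by auto

lemma power_at_pos:
  "x \<in> region g d s k E \<Longrightarrow> j \<le> k \<Longrightarrow> E > 3 \<Longrightarrow> power_at g E j x > 0"
  unfolding region_def by (auto split: if_splits dest!: spec[of _ j])

text \<open>At site \<open>N\<close> the ratio is 0 and \<open>power_at\<close> is the parameter
  itself, so the induction starts from the unit interval. The target changes to the window around
  \<open>E\<close> at level \<open>d\<close>.\<close>

lemma controlled_tail:
  assumes "E \<ge> 100" "\<And>j. j < d \<Longrightarrow> \<bar>g j\<bar> \<le> E / 4" "k \<le> d" "d \<ge> 1"
  shows "controlled E 2 0 (if k < d then {0<..<1} else {E - 3<..<E + 3})
           (region g d s k E) (power_at g E k) (ratio_at g E k)"
  using assms(3)
proof (induction k)
  case 0
  have "region g d s 0 E = {0<..<1}" using assms unfolding region_def power_at_def by auto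
  then show ?case using assms by (simp add: controlled_def power_at_def ratio_at_def)
next
  case (Suc k)
  then have ctl: "controlled E 2 0 {0<..<1} (region g d s k E) (power_at g E k) (ratio_at g E k)"
    by simp
  have "100 * E \<le> E\<^sup>2"
    unfolding power2_eq_square using assms(1) by (intro mult_right_mono) auto
  then have "E + 3 \<le> E\<^sup>2 / 8" using assms(1) by linarith
  then obtain a b where ab: "0 \<le> a" "b \<le> E\<^sup>2 / 8"
      "(if Suc k < d then {0<..<1} else {E - 3<..<E + 3}) = {a<..<b}"
    using assms(1) that[of "E - 3" "E + 3"] that[of 0 1] by (cases "Suc k < d") auto
  have pos: "power_at g E k x > 0" if "x \<in> region g d s k E" for x
    using power_at_pos[OF that] assms(1) by auto
  show ?case
    unfolding ab(3)
    by (rule controlled_cong[OF controlled_tail_step[OF assms(1) assms(2)[of k] ctl ab(1,2)]])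
      (use Suc.prems pos shoot_Suc ab(3) in \<open>auto simp: region_Suc\<close>)
qed

text \<open>Neither \<open>K'\<close> nor the threshold for \<open>E\<close> depends on the signs or
  the centre, so one threshold serves all sign patterns.\<close>

lemma controlled_nonlinear_step_eventually:
  fixes S K :: real
  assumes "\<bar>S\<bar> < 1" "K > 0"
  obtains K' where "K' > 0"
    "\<forall>\<^sub>F E in at_top. \<forall>s c. (s k = 1 \<or> s k = -1) \<and> cmod c \<le> 1 \<and> Im c = S - g k \<and> d \<le> k \<and>
       controlled E K c {E - 3<..<E + 3} (region g d s k E) (power_at g E k) (ratio_at g E k) \<longrightarrow>
       controlled E K' (Complex (s k * sqrt (1 - S\<^sup>2)) S) {E - 3<..<E + 3} (region g d s (Suc k) E)
         (power_at g E (Suc k)) (ratio_at g E (Suc k)) \<and>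
       (\<forall>x\<in>region g d s (Suc k) E. \<bar>power_at g E k x - E\<bar> \<le> 5 / 2) \<and>
       (\<forall>x\<in>region g d s (Suc k) E. \<forall>y\<in>region g d s (Suc k) E.
          \<bar>power_at g E k x - power_at g E k y\<bar> \<le> \<bar>power_at g E (Suc k) x - power_at g E (Suc k) y\<bar> / 2)"
proof -
  define q where "q = sqrt (1 - S\<^sup>2)"
  have "S\<^sup>2 < 1" using assms(1) by (simp add: abs_square_less_1)
  then have q: "q > 0" "q\<^sup>2 + S\<^sup>2 = 1" unfolding q_def by auto
  define \<mu> where "\<mu> = (12 + 3 * K) / q + K"
  have \<mu>: "\<mu> > 0" using q assms unfolding \<mu>_def by (auto intro: add_pos_pos)
  show thesis
  proof (rule that[of "2 * \<mu> + 32 / q"])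
    show "2 * \<mu> + 32 / q > 0" using \<mu> q by (auto intro: add_pos_pos)
    have bound: "\<forall>\<^sub>F E in at_top. a / E \<le> b" if "b > 0" for a b :: real
      using eventually_ge_at_top[of "a / b"] eventually_gt_at_top[of 0]
      by eventually_elim (use that in \<open>simp add: field_simps\<close>)
    have 5: "4 / (q * E) = (4 / q) / E" for E by simp
    have "\<forall>\<^sub>F E in at_top. E \<ge> 3 + 24 / q\<^sup>2" "\<forall>\<^sub>F E in at_top. K / E \<le> q\<^sup>2 / 16"
        "\<forall>\<^sub>F E in at_top. \<mu> / E \<le> q / 2" "\<forall>\<^sub>F E in at_top. (8 * K + 4) / E \<le> q / 2"
        "\<forall>\<^sub>F E in at_top. 4 / (q * E) \<le> 1 / 2" "\<forall>\<^sub>F E in at_top. E > (3::real)"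
      unfolding 5 using q by (auto intro!: bound eventually_ge_at_top eventually_gt_at_top simp del: divide_divide_eq_left)
    then show "\<forall>\<^sub>F E in at_top. \<forall>s c. (s k = 1 \<or> s k = -1) \<and> cmod c \<le> 1 \<and> Im c = S - g k \<and> d \<le> k \<and>
       controlled E K c {E - 3<..<E + 3} (region g d s k E) (power_at g E k) (ratio_at g E k) \<longrightarrow>
       controlled E (2 * \<mu> + 32 / q) (Complex (s k * sqrt (1 - S\<^sup>2)) S) {E - 3<..<E + 3} (region g d s (Suc k) E)
         (power_at g E (Suc k)) (ratio_at g E (Suc k)) \<and>
       (\<forall>x\<in>region g d s (Suc k) E. \<bar>power_at g E k x - E\<bar> \<le> 5 / 2) \<and>
       (\<forall>x\<in>region g d s (Suc k) E. \<forall>y\<in>region g d s (Suc k) E.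
          \<bar>power_at g E k x - power_at g E k y\<bar> \<le> \<bar>power_at g E (Suc k) x - power_at g E (Suc k) y\<bar> / 2)"
    proof eventually_elim
      case (elim E)
      show ?case
      proof (intro allI impI; elim conjE)
        fix s :: "nat \<Rightarrow> real" and c
        assume s: "s k = 1 \<or> s k = -1" and c: "cmod c \<le> 1" "Im c = S - g k" "d \<le> k"
          and ctl: "controlled E K c {E - 3<..<E + 3} (region g d s k E) (power_at g E k) (ratio_at g E k)"
        note step = controlled_nonlinear_step[OF q c(1,2) s assms(2) \<mu>_def elim(1-5) ctl]
        define \<Omega> where "\<Omega> = {x \<in> region g d s k E.
            power_at g E k x * (cmod (of_real E - \<i> * of_real (g k) - of_real (power_at g E k x) - ratio_at g E k x))\<^sup>2 \<in> {E - 3<..<E + 3} \<and>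
            s k * Re (of_real E - \<i> * of_real (g k) - of_real (power_at g E k x) - ratio_at g E k x) > 0}"
        note step = step[folded \<Omega>_def q_def]
        have pos: "power_at g E k x > 0" if "x \<in> region g d s k E" for x
          using power_at_pos[OF that] elim by auto
        have \<Omega>: "\<Omega> = region g d s (Suc k) E"
          unfolding region_Suc \<Omega>_def using shoot_Suc(2,4)[OF pos] c(3) by auto
        have eqs: "power_at g E (Suc k) x = power_at g E k x * (cmod (of_real E - \<i> * of_real (g k) - of_real (power_at g E k x) - ratio_at g E k x))\<^sup>2"
          "ratio_at g E (Suc k) x = 1 / (of_real E - \<i> * of_real (g k) - of_real (power_at g E k x) - ratio_at g E k x)"
          if "x \<in> \<Omega>" for x
          using shoot_Suc(2,3)[OF pos] that unfolding \<Omega>_def by auto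
        have "controlled E (2 * \<mu> + 32 / q) (Complex (s k * q) S) {E - 3<..<E + 3} \<Omega>
         (power_at g E (Suc k)) (ratio_at g E (Suc k))"
          by (rule controlled_cong[OF step(1)]) (use eqs in auto)
        moreover have "\<bar>power_at g E k x - power_at g E k y\<bar> \<le> \<bar>power_at g E (Suc k) x - power_at g E (Suc k) y\<bar> / 2"
          if "x \<in> \<Omega>" "y \<in> \<Omega>" for x y
          unfolding eqs(1)[OF that(1)] eqs(1)[OF that(2)] by (rule step(3)[OF that])
        ultimately show "controlled E (2 * \<mu> + 32 / q) (Complex (s k * sqrt (1 - S\<^sup>2)) S) {E - 3<..<E + 3} (region g d s (Suc k) E)
         (power_at g E (Suc k)) (ratio_at g E (Suc k)) \<and>
       (\<forall>x\<in>region g d s (Suc k) E. \<bar>power_at g E k x - E\<bar> \<le> 5 / 2) \<and>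
       (\<forall>x\<in>region g d s (Suc k) E. \<forall>y\<in>region g d s (Suc k) E.
          \<bar>power_at g E k x - power_at g E k y\<bar> \<le> \<bar>power_at g E (Suc k) x - power_at g E (Suc k) y\<bar> / 2)"
          using step(2) unfolding \<Omega> q_def by blast
      qed
    qed
  qed
qed

text \<open>The limit of \<open>w\<^sub>n\<^sub>+\<^sub>1 / w\<^sub>n\<close> for \<open>n = N - k\<close> as \<open>E\<close> tends to infinity.\<close>

definition center :: "(nat \<Rightarrow> real) \<Rightarrow> nat \<Rightarrow> (nat \<Rightarrow> real) \<Rightarrow> nat \<Rightarrow> complex" where
  "center g d s k =
     (if k \<le> d then 0
      else Complex (s (k - 1) * sqrt (1 - (\<Sum>j=d..<k. g j)\<^sup>2)) (\<Sum>j=d..<k. g j))"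

text \<open>Only finitely many levels occur, so constants and thresholds may worsen from level to
  level. The last two claims concern the step into level \<open>k\<close>; at \<open>k = N\<close>
  they compare \<open>|w_1|^2\<close> with \<open>|w_0|^2\<close>.\<close>

lemma controlled_region:
  assumes "d \<ge> 1" and d: "d \<le> k" "k \<le> N"
    and sum: "\<And>k. k \<in> {d..<N} \<Longrightarrow> \<bar>\<Sum>j=d..<Suc k. g j\<bar> < 1"
  shows "\<exists>K>0. \<forall>\<^sub>F E in at_top. \<forall>s. (\<forall>j\<in>{d..<N}. s j = 1 \<or> s j = -1) \<longrightarrow>
    controlled E K (center g d s k) {E - 3<..<E + 3} (region g d s k E) (power_at g E k) (ratio_at g E k) \<and>
    (d < k \<longrightarrow> (\<forall>x\<in>region g d s k E. \<bar>power_at g E (k - 1) x - E\<bar> \<le> 5 / 2) \<and>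
       (\<forall>x\<in>region g d s k E. \<forall>y\<in>region g d s k E.
          \<bar>power_at g E (k - 1) x - power_at g E (k - 1) y\<bar> \<le> \<bar>power_at g E k x - power_at g E k y\<bar> / 2))"
  using d
proof (induction k rule: dec_induct)
  case base
  have "\<forall>\<^sub>F E in at_top. E \<ge> max 100 (4 * (\<Sum>j<d. \<bar>g j\<bar>))"
    by (rule eventually_ge_at_top)
  then have "\<forall>\<^sub>F E in at_top. \<forall>s. controlled E 2 0 {E - 3<..<E + 3} (region g d s d E) (power_at g E d) (ratio_at g E d)"
  proof eventually_elim
    case (elim E)
    have "\<bar>g j\<bar> \<le> E / 4" if "j < d" for j
      using member_le_sum[of j "{..<d}" "\<lambda>j. \<bar>g j\<bar>"] that elim by simp
    then show ?case using controlled_tail[of E d g d] elim assms(1) by auto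
  qed
  then show ?case
    by (intro exI[of _ 2]) (auto simp: center_def elim!: eventually_mono)
next
  case (step k)
  have "k \<le> N" using step by simp
  from step.IH[OF this] obtain K where K: "K > 0" "\<forall>\<^sub>F E in at_top. \<forall>s. (\<forall>j\<in>{d..<N}. s j = 1 \<or> s j = -1) \<longrightarrow>
    controlled E K (center g d s k) {E - 3<..<E + 3} (region g d s k E) (power_at g E k) (ratio_at g E k)"
    by (elim exE conjE) (rule that, assumption, erule eventually_mono, blast)
  define S where "S = (\<Sum>j=d..<Suc k. g j)"
  have S: "\<bar>S\<bar> < 1" unfolding S_def using sum[of k] step by auto
  from controlled_nonlinear_step_eventually[OF S K(1), of k g d] obtain K' where K': "K' > 0"
    "\<forall>\<^sub>F E in at_top. \<forall>s c. (s k = 1 \<or> s k = -1) \<and> cmod c \<le> 1 \<and> Im c = S - g k \<and> d \<le> k \<and>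
       controlled E K c {E - 3<..<E + 3} (region g d s k E) (power_at g E k) (ratio_at g E k) \<longrightarrow>
       controlled E K' (Complex (s k * sqrt (1 - S\<^sup>2)) S) {E - 3<..<E + 3} (region g d s (Suc k) E)
         (power_at g E (Suc k)) (ratio_at g E (Suc k)) \<and>
       (\<forall>x\<in>region g d s (Suc k) E. \<bar>power_at g E k x - E\<bar> \<le> 5 / 2) \<and>
       (\<forall>x\<in>region g d s (Suc k) E. \<forall>y\<in>region g d s (Suc k) E.
          \<bar>power_at g E k x - power_at g E k y\<bar> \<le> \<bar>power_at g E (Suc k) x - power_at g E (Suc k) y\<bar> / 2)"
    by blast
  show ?case
  proof (intro exI[of _ K'] conjI K'(1))
    from K(2) K'(2) show "\<forall>\<^sub>F E in at_top. \<forall>s. (\<forall>j\<in>{d..<N}. s j = 1 \<or> s j = -1) \<longrightarrow>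
      controlled E K' (center g d s (Suc k)) {E - 3<..<E + 3} (region g d s (Suc k) E) (power_at g E (Suc k)) (ratio_at g E (Suc k)) \<and>
      (d < Suc k \<longrightarrow> (\<forall>x\<in>region g d s (Suc k) E. \<bar>power_at g E (Suc k - 1) x - E\<bar> \<le> 5 / 2) \<and>
       (\<forall>x\<in>region g d s (Suc k) E. \<forall>y\<in>region g d s (Suc k) E.
          \<bar>power_at g E (Suc k - 1) x - power_at g E (Suc k - 1) y\<bar> \<le> \<bar>power_at g E (Suc k) x - power_at g E (Suc k) y\<bar> / 2))"
    proof eventually_elim
      case (elim E)
      show ?case
      proof (intro allI impI)
        fix s :: "nat \<Rightarrow> real" assume s: "\<forall>j\<in>{d..<N}. s j = 1 \<or> s j = -1"
        \<comment> \<open>The centre is 0 at level \<open>d\<close> and lies on the unit circle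
          afterwards.\<close>
        have "cmod (center g d s k) \<le> 1"
        proof (cases "k = d")
          case False
          define T where "T = (\<Sum>j=d..<k. g j)"
          have "k - 1 \<in> {d..<N}" "Suc (k - 1) = k" using False step by auto
          then have "\<bar>T\<bar> < 1" "s (k - 1) = 1 \<or> s (k - 1) = -1"
            using sum[of "k - 1"] s unfolding T_def by auto
          then have "T\<^sup>2 \<le> 1" "(s (k - 1))\<^sup>2 = 1" by (auto simp: abs_square_le_1)
          then show ?thesis
            using False step unfolding center_def T_def[symmetric] by (simp add: cmod_def power_mult_distrib)
        qed (simp add: center_def)
        moreover have "Im (center g d s k) = S - g k"
          using step unfolding center_def S_def by simp
        moreover have "s k = 1 \<or> s k = -1" using s step by auto
        ultimately have "controlled E K' (Complex (s k * sqrt (1 - S\<^sup>2)) S) {E - 3<..<E + 3} (region g d s (Suc k) E)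
            (power_at g E (Suc k)) (ratio_at g E (Suc k)) \<and>
          (\<forall>x\<in>region g d s (Suc k) E. \<bar>power_at g E k x - E\<bar> \<le> 5 / 2) \<and>
          (\<forall>x\<in>region g d s (Suc k) E. \<forall>y\<in>region g d s (Suc k) E.
            \<bar>power_at g E k x - power_at g E k y\<bar> \<le> \<bar>power_at g E (Suc k) x - power_at g E (Suc k) y\<bar> / 2)"
          using elim s step(1) by blast
        moreover have "center g d s (Suc k) = Complex (s k * sqrt (1 - S\<^sup>2)) S"
          using step unfolding center_def S_def by simp
        ultimately show "controlled E K' (center g d s (Suc k)) {E - 3<..<E + 3} (region g d s (Suc k) E) (power_at g E (Suc k)) (ratio_at g E (Suc k)) \<and>
      (d < Suc k \<longrightarrow> (\<forall>x\<in>region g d s (Suc k) E. \<bar>power_at g E (Suc k - 1) x - E\<bar> \<le> 5 / 2) \<and>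
       (\<forall>x\<in>region g d s (Suc k) E. \<forall>y\<in>region g d s (Suc k) E.
          \<bar>power_at g E (Suc k - 1) x - power_at g E (Suc k - 1) y\<bar> \<le> \<bar>power_at g E (Suc k) x - power_at g E (Suc k) y\<bar> / 2))"
          by simp
      qed
    qed
  qed
qed

subsection \<open>Existence and uniqueness of the crossing\<close>

text \<open>Over the window \<open>p\<close> comes closer to the ends than \<open>p0\<close> can,
  and \<open>p0\<close> has slope at most \<open>1 / 2\<close> relative to \<open>p\<close>. So
  \<open>p - p0\<close> changes sign, and its differences are at least half those of
  \<open>p\<close>, hence of \<open>x\<close>.\<close>

lemma controlled_crossing:
  assumes ctl: "controlled E K c {E - 3<..<E + 3} \<Omega> p r" and "K / E \<ge> 0"
    and near: "\<And>x. x \<in> \<Omega> \<Longrightarrow> \<bar>p0 x - E\<bar> \<le> 5 / 2"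
    and lip: "\<And>x y. x \<in> \<Omega> \<Longrightarrow> y \<in> \<Omega> \<Longrightarrow> \<bar>p0 x - p0 y\<bar> \<le> \<bar>p x - p y\<bar> / 2"
  shows "\<exists>x\<in>\<Omega>. p x = p0 x"
    and "\<And>x y. x \<in> \<Omega> \<Longrightarrow> y \<in> \<Omega> \<Longrightarrow> \<bar>x - y\<bar> \<le> 2 * \<bar>(p x - p0 x) - (p y - p0 y)\<bar>"
proof -
  obtain \<xi> where \<xi>: "\<And>t. t \<in> {E - 3<..<E + 3} \<Longrightarrow> \<xi> t \<in> \<Omega> \<and> p (\<xi> t) = t"
    using controlled_inverse[OF ctl assms(2)] by blast
  have "(1 / 2)-lipschitz_on {E - 3<..<E + 3} (\<lambda>t. p0 (\<xi> t))"
  proof (rule lipschitz_onI)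
    fix s t assume "s \<in> {E - 3<..<E + 3}" "t \<in> {E - 3<..<E + 3}"
    then show "dist (p0 (\<xi> s)) (p0 (\<xi> t)) \<le> 1 / 2 * dist s t"
      using lip[of "\<xi> s" "\<xi> t"] \<xi>[of s] \<xi>[of t] by (simp add: dist_real_def)
  qed simp
  then have "continuous_on {E - 3<..<E + 3} (\<lambda>t. t - p0 (\<xi> t))"
    by (intro continuous_intros lipschitz_on_continuous_on)
  \<comment> \<open>\<open>11 / 4\<close> is chosen strictly between \<open>5 / 2\<close> and
    3.\<close>
  moreover obtain a b where ab: "E - 3 < a" "a < E - 5 / 2" "E + 5 / 2 < b" "b < E + 3"
    using that[of "E - 11 / 4" "E + 11 / 4"] by auto
  then have I: "a \<in> {E - 3<..<E + 3}" "b \<in> {E - 3<..<E + 3}" "{a..b} \<subseteq> {E - 3<..<E + 3}"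
    by auto
  ultimately have "continuous_on {a..b} (\<lambda>t. t - p0 (\<xi> t))"
    using continuous_on_subset by blast
  moreover have "a - p0 (\<xi> a) \<le> 0"
    using abs_le_D2[OF near[of "\<xi> a"]] \<xi>[OF I(1)] ab(2) by simp
  moreover have "0 \<le> b - p0 (\<xi> b)"
    using abs_le_D1[OF near[of "\<xi> b"]] \<xi>[OF I(2)] ab(3) by simp
  ultimately obtain t where "a \<le> t" "t \<le> b" "t - p0 (\<xi> t) = 0"
    using IVT'[of "\<lambda>t. t - p0 (\<xi> t)" a 0 b] ab by auto
  then show "\<exists>x\<in>\<Omega>. p x = p0 x"
    using \<xi>[of t] ab by (intro bexI[of _ "\<xi> t"]) auto
  show "\<bar>x - y\<bar> \<le> 2 * \<bar>(p x - p0 x) - (p y - p0 y)\<bar>" if xy: "x \<in> \<Omega>" "y \<in> \<Omega>" for x y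
  proof -
    have "\<bar>x - y\<bar> \<le> \<bar>p x - p y\<bar>" using ctl xy unfolding controlled_def by blast
    moreover have "a \<le> 2 * c" if "b \<le> a / 2" "a - b \<le> c" for a b c :: real
      using that by linarith
    from this[OF lip[OF xy] abs_triangle_ineq2]
    have "\<bar>p x - p y\<bar> \<le> 2 * \<bar>(p x - p y) - (p0 x - p0 y)\<bar>" .
    ultimately show ?thesis by (simp add: algebra_simps)
  qed
qed

text \<open>Each step from level \<open>k + 1\<close> back to \<open>k\<close> costs a factor
  \<open>(2 / E)^2\<close>. Starting from \<open>|w_M|^2 < E + 3\<close>, this gives
  \<open>8 / E\<close> at site \<open>M + 1\<close>, and the sites beyond are no larger.\<close>

lemma power_at_tail_le:
  assumes E: "E \<ge> 100" "\<And>j. j < d \<Longrightarrow> \<bar>g j\<bar> \<le> E / 4" and "d \<le> N" and x: "x \<in> region g d s N E" and j: "j < d"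
  shows "power_at g E j x \<le> 8 / E"
proof -
  have down: "power_at g E k x \<le> (2 / E)\<^sup>2 * power_at g E (Suc k) x" if "k < d" for k
  proof -
    have pos: "power_at g E (Suc k) x > 0" using power_at_pos[OF x, of "Suc k"] that assms by auto
    then have nz: "shoot g (Suc k) x E \<noteq> 0" by (auto simp: power_at_def)
    have "x \<in> region g d s (Suc k) E" using x region_mono[of "Suc k" N g d s E] that assms by auto
    then have "cmod (ratio_at g E (Suc k) x - 0) \<le> 2 / E"
      using controlled_tail[where k = "Suc k" and s = s, OF E] that j unfolding controlled_def by auto
    then have "(cmod (ratio_at g E (Suc k) x))\<^sup>2 * power_at g E (Suc k) x \<le> (2 / E)\<^sup>2 * power_at g E (Suc k) x"
      using pos by (intro mult_right_mono power_mono) auto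
    moreover have "(cmod (ratio_at g E (Suc k) x))\<^sup>2 * power_at g E (Suc k) x = power_at g E k x"
      using nz by (simp add: ratio_at_def power_at_def norm_divide power_divide)
    ultimately show ?thesis by simp
  qed
  have "j \<le> d - 1" using j by simp
  then show ?thesis
  proof (induction j rule: inc_induct)
    case base
    have "power_at g E d x < E + 3"
      using x assms(3) unfolding region_def by auto
    then have "power_at g E (d - 1) x \<le> (2 / E)\<^sup>2 * (2 * E)"
      using order_trans[OF down[of "d - 1"] mult_left_mono[of _ "2 * E" "(2 / E)\<^sup>2"]] j E(1) by simp
    also have "\<dots> = 8 / E" using E by (simp add: power2_eq_square)
    finally show ?case .
  next
    case (step k)
    have "(2 / E)\<^sup>2 \<le> 1\<^sup>2" using E(1) by (intro power_mono) auto
    moreover have "power_at g E (Suc k) x > 0" using power_at_pos[OF x, of "Suc k"] step(2) assms j by auto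
    ultimately have "(2 / E)\<^sup>2 * power_at g E (Suc k) x \<le> power_at g E (Suc k) x"
      by (intro mult_left_le_one_le) auto
    then show ?case using \<open>power_at g E (Suc k) x \<le> 8 / E\<close> down[of k] step(2) j by linarith
  qed
qed

lemma open_region:
  "open {p. snd p > E0 \<and> fst p \<in> region g d s N (snd p)}"
proof -
  have cont: "continuous_on UNIV (\<lambda>p. shoot g j (fst p) (snd p))" for j
    by (rule conj_polynomial_continuous[OF conj_polynomial_shoot])
  have "{p. snd p > E0 \<and> fst p \<in> region g d s N (snd p)} =
      {p. snd p > E0} \<inter>
      (\<Inter>j\<in>{..N}. {p. power_at g (snd p) j (fst p) \<in> (if j < d then {0<..<1} else {snd p - 3<..<snd p + 3})}) \<inter>
      (\<Inter>j\<in>{d..<N}. {p. s j * Re (shoot g (Suc j) (fst p) (snd p) * cnj (shoot g j (fst p) (snd p))) > 0})"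
    unfolding region_def by auto
  also have "open \<dots>"
  proof (intro open_Int open_INT finite_atMost finite_atLeastLessThan ballI)
    show "open {p::real \<times> real. snd p > E0}"
      by (intro open_Collect_less continuous_intros)
  next
    fix j
    have "open {p. a p < power_at g (snd p) j (fst p) \<and> power_at g (snd p) j (fst p) < b p}"
      if "continuous_on UNIV a" "continuous_on UNIV b" for a b
      unfolding power_at_def
      by (intro open_Collect_conj open_Collect_less continuous_intros cont that)
    note between = this
    have shifts: "continuous_on UNIV (\<lambda>p::real \<times> real. snd p - 3)" "continuous_on UNIV (\<lambda>p::real \<times> real. snd p + 3)"
      by (intro continuous_intros)+
    from between[OF continuous_on_const continuous_on_const, of 0 1] between[OF shifts] show "open {p. power_at g (snd p) j (fst p) \<in> (if j < d then {0<..<1} else {snd p - 3<..<snd p + 3})}"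
      by (cases "j < d") auto
  next
    fix j
    show "open {p. s j * Re (shoot g (Suc j) (fst p) (snd p) * cnj (shoot g j (fst p) (snd p))) > 0}"
      by (intro open_Collect_less continuous_intros cont)
  qed
  finally show ?thesis .
qed

subsection \<open>Meeting the boundary condition\<close>

text \<open>When \<open>|v0| = |v1|\<close>, the rotation \<open>\<kappa>\<close> with \<open>\<kappa> v0 = cnj (\<kappa> v1)\<close> is a square root of \<open>cnj v1 / v0\<close>; this closed form is
  smooth as long as \<open>\<sigma> Re (v0 / v1) > 0\<close>, so no branch of the complex square root has to be chosen.\<close>

definition phase :: "real \<Rightarrow> complex \<Rightarrow> complex \<Rightarrow> complex" where
  "phase \<sigma> v0 v1 = (if \<sigma> = 1 then 1 else \<i>) * cnj (v1 + of_real \<sigma> * v0) / of_real (cmod (v1 + of_real \<sigma> * v0))"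

lemma phase_nonzero:
  assumes "\<sigma> = 1 \<or> \<sigma> = -1" "\<sigma> * Re (v0 * cnj v1) > 0"
  shows "v1 + of_real \<sigma> * v0 \<noteq> 0"
proof
  assume "v1 + of_real \<sigma> * v0 = 0"
  then have "v1 = - of_real \<sigma> * v0" by (simp add: add_eq_0_iff)
  then have "v0 * cnj v1 = of_real (- \<sigma> * (cmod v0)\<^sup>2)"
    by (simp add: complex_norm_square[symmetric] del: of_real_power)
  then have "\<sigma> * Re (v0 * cnj v1) = - (\<sigma> * \<sigma> * (cmod v0)\<^sup>2)"
    by (simp only: Re_complex_of_real)
  also have "\<dots> \<le> 0" by simp
  finally show False using assms(2) by simp
qed

text \<open>For \<open>\<sigma> = 1\<close> both sides of the second claim equal
  \<open>v0 * cnj v1 + |v0|^2\<close> up to the common normalisation. For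
  \<open>\<sigma> = -1\<close> the sum becomes a difference, and the factor \<open>\<i>\<close>
  absorbs its change of sign.\<close>

lemma phase:
  assumes \<sigma>: "\<sigma> = 1 \<or> \<sigma> = -1" and z: "v1 + of_real \<sigma> * v0 \<noteq> 0"
    and eq: "cmod v0 = cmod v1"
  shows "cmod (phase \<sigma> v0 v1) = 1" and "phase \<sigma> v0 v1 * v0 = cnj (phase \<sigma> v0 v1 * v1)"
proof -
  show "cmod (phase \<sigma> v0 v1) = 1"
    using z by (simp add: phase_def norm_mult norm_divide del: complex_cnj_add complex_cnj_mult)
  have "v0 * cnj v0 = v1 * cnj v1" using eq by (simp add: complex_norm_square[symmetric])
  then have "(if \<sigma> = 1 then 1 else \<i>) * cnj (v1 + of_real \<sigma> * v0) * v0
      = cnj (if \<sigma> = 1 then 1 else \<i>) * (v1 + of_real \<sigma> * v0) * cnj v1"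
    using \<sigma> by (auto simp: algebra_simps)
  then show "phase \<sigma> v0 v1 * v0 = cnj (phase \<sigma> v0 v1 * v1)"
    unfolding phase_def by (simp add: divide_inverse mult_ac)
qed

text \<open>At \<open>n = 0\<close> the formula yields the boundary value. At
  \<open>n = N + 1\<close> truncated subtraction prevents it from vanishing, so the 0 there comes
  from \<open>site_ext\<close>.\<close>

definition wave :: "(nat \<Rightarrow> real) \<Rightarrow> nat \<Rightarrow> real \<Rightarrow> real \<Rightarrow> real \<Rightarrow> nat \<Rightarrow> complex" where
  "wave g N \<sigma> x E n =
     of_real (sqrt x) * phase \<sigma> (shoot g N x E) (shoot g (N - 1) x E) * shoot g (N - n) x E"

text \<open>The recursion commutes with the constant phase, and the scaling makes
  \<open>|w_N|^2 = x\<close>. In the last claim the phase cancels, so the prescribed signs can be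
  read off from the solution and will separate the solutions.\<close>

lemma wave:
  fixes g :: "nat \<Rightarrow> real" and x E :: real
  assumes N: "N \<ge> 1" and g: "g = (\<lambda>k. \<gamma> (N - k))" and x: "x > 0"
    and \<sigma>: "\<sigma> = 1 \<or> \<sigma> = -1" and cross: "power_at g E N x = power_at g E (N - 1) x"
    and sgn: "\<sigma> * Re (shoot g N x E * cnj (shoot g (N - 1) x E)) > 0"
  shows "(cmod (wave g N \<sigma> x E n))\<^sup>2 = power_at g E (N - n) x"
    and "k \<le> N \<Longrightarrow> site_ext N (wave g N \<sigma> x E) (N - k) = wave g N \<sigma> x E (N - k)"
    and "stationary_solution N \<gamma> E (wave g N \<sigma> x E)"
    and "Re (wave g N \<sigma> x E m * cnj (wave g N \<sigma> x E n))
       = x * Re (shoot g (N - m) x E * cnj (shoot g (N - n) x E))"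
proof -
  let ?v0 = "shoot g N x E" and ?v1 = "shoot g (N - 1) x E"
  define \<kappa> where "\<kappa> = phase \<sigma> ?v0 ?v1"
  have w: "wave g N \<sigma> x E n = of_real (sqrt x) * \<kappa> * shoot g (N - n) x E" for n
    unfolding wave_def \<kappa>_def ..
  have "cmod ?v0 = cmod ?v1"
    using cross x unfolding power_at_def by simp
  moreover have "?v1 + of_real \<sigma> * ?v0 \<noteq> 0" by (rule phase_nonzero[OF \<sigma> sgn])
  ultimately have \<kappa>: "cmod \<kappa> = 1" "\<kappa> * ?v0 = cnj (\<kappa> * ?v1)"
    using phase[OF \<sigma>] unfolding \<kappa>_def by auto
  show norm: "(cmod (wave g N \<sigma> x E n))\<^sup>2 = power_at g E (N - n) x" for n
    using \<kappa>(1) x unfolding w power_at_def by (simp add: norm_mult power_mult_distrib)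
  have "\<kappa> * cnj \<kappa> = 1" using \<kappa>(1) by (simp add: complex_norm_square[symmetric])
  moreover have "wave g N \<sigma> x E m * cnj (wave g N \<sigma> x E n)
      = of_real (sqrt x * sqrt x) * (\<kappa> * cnj \<kappa>) * (shoot g (N - m) x E * cnj (shoot g (N - n) x E))"
    by (simp only: w complex_cnj_mult complex_cnj_complex_of_real of_real_mult mult_ac)
  moreover have "sqrt x * sqrt x = x" using x by simp
  ultimately have "wave g N \<sigma> x E m * cnj (wave g N \<sigma> x E n)
      = of_real x * (shoot g (N - m) x E * cnj (shoot g (N - n) x E))"
    by (simp only: mult_1_right)
  then show "Re (wave g N \<sigma> x E m * cnj (wave g N \<sigma> x E n))
       = x * Re (shoot g (N - m) x E * cnj (shoot g (N - n) x E))"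
    by simp
  have w0: "wave g N \<sigma> x E 0 = cnj (wave g N \<sigma> x E 1)"
    using \<kappa>(2) unfolding w by (simp add: mult.assoc)
  show ext: "site_ext N (wave g N \<sigma> x E) (N - k) = wave g N \<sigma> x E (N - k)" if "k \<le> N" for k
    unfolding site_ext_def using w0 by auto
  show "stationary_solution N \<gamma> E (wave g N \<sigma> x E)"
    unfolding stationary_solution_def
  proof
    fix n assume n: "n \<in> {1..N}"
    define k where "k = N - n"
    have k: "k < N" "n = N - k" "n - 1 = N - Suc k" "N - (n - 1) = Suc k" "N - n = k" using n unfolding k_def by auto
    have gk: "g k = \<gamma> n" using g k by simp
    have rec: "of_real E * shoot g k x E = (if k = 0 then 0 else shoot g (k - 1) x E) + shoot g (Suc k) x E
        + \<i> * of_real (g k) * shoot g k x E + of_real (power_at g E k x) * shoot g k x E"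
      unfolding power_at_def by (cases k) (auto simp: algebra_simps)
    have left: "site_ext N (wave g N \<sigma> x E) (n - 1) = of_real (sqrt x) * \<kappa> * shoot g (Suc k) x E"
      unfolding k(3) using ext[of "Suc k"] k by (simp add: w)
    have right: "site_ext N (wave g N \<sigma> x E) (n + 1) = of_real (sqrt x) * \<kappa> * (if k = 0 then 0 else shoot g (k - 1) x E)"
    proof (cases "k = 0")
      case True
      then show ?thesis using k by (simp add: site_ext_def)
    next
      case False
      then have "n + 1 = N - (k - 1)" using k by auto
      then show ?thesis using ext[of "k - 1"] k False by (simp add: w)
    qed
    have "of_real E * wave g N \<sigma> x E n = of_real (sqrt x) * \<kappa> * (of_real E * shoot g k x E)"
      unfolding w k(5) by simp
    then show "of_real E * wave g N \<sigma> x E n =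
        site_ext N (wave g N \<sigma> x E) (n + 1) + site_ext N (wave g N \<sigma> x E) (n - 1)
        + \<i> * of_real (\<gamma> n) * wave g N \<sigma> x E n + of_real ((cmod (wave g N \<sigma> x E n))\<^sup>2) * wave g N \<sigma> x E n"
      unfolding left right norm unfolding w k(5) rec gk[symmetric] by (simp add: algebra_simps)
  qed
qed

lemma times_differentiable_on_wave:
  assumes S: "open S" and x: "times_differentiable_on k S \<xi>" "\<And>E. E \<in> S \<Longrightarrow> \<xi> E > 0"
    and nz: "\<And>E. E \<in> S \<Longrightarrow> shoot g (N - 1) (\<xi> E) E + of_real \<sigma> * shoot g N (\<xi> E) E \<noteq> 0"
  shows "times_differentiable_on k S (\<lambda>E. wave g N \<sigma> (\<xi> E) E n)"
proof -
  let ?z = "\<lambda>E. shoot g (N - 1) (\<xi> E) E + of_real \<sigma> * shoot g N (\<xi> E) E"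
  have sh: "times_differentiable_on k S (\<lambda>E. shoot g m (\<xi> E) E)" for m
    by (rule times_differentiable_on_conj_polynomial[OF x(1) conj_polynomial_shoot])
  have z: "times_differentiable_on k S ?z"
    by (intro times_differentiable_on_add times_differentiable_on_mult times_differentiable_on_const sh)
  have zz: "Re (?z E * cnj (?z E)) > 0" "sqrt (Re (?z E * cnj (?z E))) = cmod (?z E)" if "E \<in> S" for E
  proof -
    have sq: "Re (z * cnj z) = (cmod z)\<^sup>2" for z
      by (metis Re_complex_of_real complex_norm_square)
    then show "Re (?z E * cnj (?z E)) > 0" "sqrt (Re (?z E * cnj (?z E))) = cmod (?z E)"
      unfolding sq using nz[OF that] by auto
  qed
  \<comment> \<open>The root is written as \<open>\<xi> E\<close> times its inverse root, and the
    modulus through \<open>z * cnj z\<close>, so that only inverse square roots of positive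
    functions occur.\<close>
  have "times_differentiable_on k S
     (\<lambda>E. of_real (\<xi> E * inverse (sqrt (\<xi> E))) * ((if \<sigma> = 1 then 1 else \<i>) * cnj (?z E) *
        of_real (inverse (sqrt (Re (?z E * cnj (?z E)))))) * shoot g (N - n) (\<xi> E) E)"
    by (intro times_differentiable_on_mult times_differentiable_on_const sh z
        times_differentiable_on_bounded_linear[OF bounded_linear_of_real]
        times_differentiable_on_bounded_linear[OF bounded_linear_Re]
        times_differentiable_on_bounded_linear[OF bounded_linear_cnj]
        times_differentiable_on_inverse_sqrt x zz)
  moreover have "of_real (\<xi> E * inverse (sqrt (\<xi> E))) * ((if \<sigma> = 1 then 1 else \<i>) * cnj (?z E) *
        of_real (inverse (sqrt (Re (?z E * cnj (?z E)))))) * shoot g (N - n) (\<xi> E) E = wave g N \<sigma> (\<xi> E) E n"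
    if "E \<in> S" for E
  proof -
    have "\<xi> E * inverse (sqrt (\<xi> E)) = sqrt (\<xi> E)"
      using x(2)[OF that] by (simp add: divide_inverse[symmetric] real_div_sqrt)
    then show ?thesis
      by (simp only: wave_def phase_def zz(2)[OF that] divide_inverse of_real_inverse)
  qed
  ultimately show ?thesis
    by (rule times_differentiable_on_cong[OF S, rotated])
qed

section \<open>Sign patterns as binary numbers, and assembly of the solutions\<close>

lemma sum_shifted_reflect:
  fixes \<gamma> :: "nat \<Rightarrow> real"
  assumes "M \<le> N" "k < N" "N - M \<le> k"
  shows "(\<Sum>j=N-M..<Suc k. \<gamma> (N - j)) = (\<Sum>n=N-k..M. \<gamma> n)"
  by (rule sum.reindex_bij_witness[of _ "\<lambda>n. N - n" "\<lambda>j. N - j"]) (use assms in auto)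

lemma eq_if_same_bits:
  fixes i j :: nat
  assumes "i < 2 ^ M" "j < 2 ^ M" "\<And>m. m < M \<Longrightarrow> bit i m = bit j m"
  shows "i = j"
proof (rule bit_eqI)
  fix m
  show "bit i m = bit j m"
    using assms(3)[of m] assms(1,2) by (cases "m < M") (metis bit_take_bit_iff take_bit_nat_eq_self)+
qed

theorem theorem4p2:
  fixes N M :: nat and \<gamma> :: "nat \<Rightarrow> real"
  assumes "N \<ge> 2" and "M \<in> {1..N - 1}"
    and "\<And>K. K \<in> {1..M} \<Longrightarrow> \<bar>\<Sum>n = K..M. \<gamma> n\<bar> < 1"
  shows "\<exists>E0 > 0. \<exists>C > 0. \<exists>W :: nat \<Rightarrow> real \<Rightarrow> nat \<Rightarrow> complex.
           (\<forall>j < 2 ^ M.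
              (\<forall>n\<in>{1..N}. C_infinity_on {E0<..} (\<lambda>E. W j E n)) \<and>
              (\<forall>E > E0.
                 stationary_solution N \<gamma> E (W j E) \<and>
                 (\<forall>n\<in>{1..M}. \<bar>(cmod (W j E n))\<^sup>2 - E\<bar> \<le> C) \<and>
                 (\<forall>n\<in>{M + 1..N}. (cmod (W j E n))\<^sup>2 \<le> C / E))) \<and>
           (\<forall>i < 2 ^ M. \<forall>j < 2 ^ M. i \<noteq> j \<longrightarrow>
              (\<forall>E > E0. \<not> gauge_equivalent N (W i E) (W j E)))"
proof -
  define g where "g = (\<lambda>k. \<gamma> (N - k))"
  define d where "d = N - M"
  have d: "d \<ge> 1" "d < N" "N - d = M" "N - M = d" "M \<le> N" using assms(2) by (auto simp: d_def)
  have sum: "\<bar>\<Sum>j=d..<Suc k. g j\<bar> < 1" if "k \<in> {d..<N}" for k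
  proof -
    have "(\<Sum>j=d..<Suc k. g j) = (\<Sum>n=N-k..M. \<gamma> n)"
      using sum_shifted_reflect[of M N k \<gamma>] that d unfolding g_def d_def by auto
    moreover have "N - k \<in> {1..M}" using that d by auto
    ultimately show ?thesis using assms(3) by presburger
  qed
  define R where "R = (\<lambda>s E. region g d s N E)"
  obtain K where K: "K > 0" and ev: "\<forall>\<^sub>F E in at_top. \<forall>s. (\<forall>j\<in>{d..<N}. s j = 1 \<or> s j = -1) \<longrightarrow>
    controlled E K (center g d s N) {E - 3<..<E + 3} (R s E) (power_at g E N) (ratio_at g E N) \<and>
    (\<forall>x\<in>R s E. \<bar>power_at g E (N - 1) x - E\<bar> \<le> 5 / 2) \<and>
    (\<forall>x\<in>R s E. \<forall>y\<in>R s E.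
      \<bar>power_at g E (N - 1) x - power_at g E (N - 1) y\<bar> \<le> \<bar>power_at g E N x - power_at g E N y\<bar> / 2)"
    using controlled_region[OF d(1) _ _ sum, of N] d(2) unfolding R_def by auto
  obtain E1 where E1: "\<And>E s. E \<ge> E1 \<Longrightarrow> \<forall>j\<in>{d..<N}. s j = 1 \<or> s j = -1 \<Longrightarrow>
    controlled E K (center g d s N) {E - 3<..<E + 3} (R s E) (power_at g E N) (ratio_at g E N) \<and>
    (\<forall>x\<in>R s E. \<bar>power_at g E (N - 1) x - E\<bar> \<le> 5 / 2) \<and>
    (\<forall>x\<in>R s E. \<forall>y\<in>R s E.
      \<bar>power_at g E (N - 1) x - power_at g E (N - 1) y\<bar> \<le> \<bar>power_at g E N x - power_at g E N y\<bar> / 2)"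
    using ev unfolding eventually_at_top_linorder by blast
  \<comment> \<open>\<open>E1\<close> controls the regions; the other two entries meet the
    hypotheses of the tail estimates.\<close>
  define E0 where "E0 = max E1 (max 100 (4 * (\<Sum>j<d. \<bar>g j\<bar>)))"
  have E0: "E \<ge> E1" "E \<ge> 100" "E > 3" "\<And>j. j < d \<Longrightarrow> \<bar>g j\<bar> \<le> E / 4" if "E > E0" for E
  proof -
    show "E \<ge> E1" "E \<ge> 100" "E > 3" using that by (auto simp: E0_def)
    show "\<bar>g j\<bar> \<le> E / 4" if "j < d" for j
      using member_le_sum[of j "{..<d}" "\<lambda>j. \<bar>g j\<bar>"] that \<open>E > E0\<close> by (simp add: E0_def)
  qed
  \<comment> \<open>Bit \<open>m\<close> of \<open>j\<close> is the sign at level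
    \<open>d + m\<close>, that is at site \<open>M - m\<close>.\<close>
  define sg :: "nat \<Rightarrow> nat \<Rightarrow> real" where "sg = (\<lambda>j k. if bit j (k - d) then 1 else -1)"
  have sg: "sg j k = 1 \<or> sg j k = -1" for j k by (simp add: sg_def)
  \<comment> \<open>The choice is harmless: by \<open>inj\<close> below the root in each region is
    unique.\<close>
  define \<xi> where "\<xi> = (\<lambda>j E. SOME x. x \<in> R (sg j) E \<and> power_at g E N x = power_at g E (N - 1) x)"
  have cross: "\<exists>x\<in>R (sg j) E. power_at g E N x = power_at g E (N - 1) x"
    and inj: "\<And>x y. x \<in> R (sg j) E \<Longrightarrow> y \<in> R (sg j) E \<Longrightarrow>
        \<bar>x - y\<bar> \<le> 2 * \<bar>(power_at g E N x - power_at g E (N - 1) x) - (power_at g E N y - power_at g E (N - 1) y)\<bar>"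
    if "E > E0" for j E
    using controlled_crossing[of E K "center g d (sg j) N" "R (sg j) E" "power_at g E N" "ratio_at g E N" "power_at g E (N - 1)"]
      E1[OF E0(1)[OF that], of "sg j"] sg K E0(2)[OF that] by auto
  have \<xi>: "\<xi> j E \<in> R (sg j) E" "power_at g E N (\<xi> j E) = power_at g E (N - 1) (\<xi> j E)" if "E > E0" for j E
    using someI_ex[of "\<lambda>x. x \<in> R (sg j) E \<and> power_at g E N x = power_at g E (N - 1) x"] cross[OF that]
    unfolding \<xi>_def by blast+
  have \<xi>pos: "\<xi> j E > 0" if "E > E0" for j E
    using power_at_pos[OF \<xi>(1)[OF that, unfolded R_def], of 0 j] E0(3)[OF that] by (simp add: power_at_def)
  have signs: "sg j k * Re (shoot g (Suc k) (\<xi> j E) E * cnj (shoot g k (\<xi> j E) E)) > 0"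
    if "E > E0" "k \<in> {d..<N}" for j E k
    using \<xi>(1)[OF that(1), of j] that(2) unfolding R_def region_def by blast
  define W where "W = (\<lambda>j E. wave g N (sg j (N - 1)) (\<xi> j E) E)"
  have last: "sg j (N - 1) * Re (shoot g N (\<xi> j E) E * cnj (shoot g (N - 1) (\<xi> j E) E)) > 0"
    if "E > E0" for j E
    using signs[OF that, of "N - 1"] d assms(1) by simp
  have N1: "N \<ge> 1" using assms(1) by simp
  note wv = wave[OF N1 g_def \<xi>pos sg \<xi>(2) last]
  have norm: "(cmod (W j E n))\<^sup>2 = power_at g E (N - n) (\<xi> j E)"
    and ext: "l \<le> N \<Longrightarrow> site_ext N (W j E) (N - l) = W j E (N - l)"
    and sol: "stationary_solution N \<gamma> E (W j E)"
    and link: "Re (W j E m * cnj (W j E n))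
       = \<xi> j E * Re (shoot g (N - m) (\<xi> j E) E * cnj (shoot g (N - n) (\<xi> j E) E))"
    if "E > E0" for j E m n l
    unfolding W_def by (rule wv[OF that that that], assumption?)+
  have smooth: "C_infinity_on {E0<..} (\<lambda>E. W j E n)" for j n
  proof (rule C_infinity_on_if_times_differentiable_on)
    fix k
    \<comment> \<open>Written with \<open>v * cnj v\<close>, the difference of
      \<open>|w_0|^2\<close> and \<open>|w_1|^2\<close> becomes a
      \<open>conj_polynomial\<close>.\<close>
    define F where "F = (\<lambda>x E. of_real x * (shoot g N x E * cnj (shoot g N x E)
        - shoot g (N - 1) x E * cnj (shoot g (N - 1) x E)))"
    have F: "conj_polynomial F"
      unfolding F_def by (intro conj_polynomial_diff conj_polynomial.intros conj_polynomial_shoot)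
    have ReF: "Re (F x E) = power_at g E N x - power_at g E (N - 1) x" for x E
      unfolding F_def power_at_def complex_norm_square[symmetric] by (simp add: right_diff_distrib)
    have "times_differentiable_on k {E0<..} (\<xi> j)"
    proof (rule implicit_function_times_differentiable_on[OF F open_region[of E0 g d "sg j" N]])
      show "(\<xi> j E, E) \<in> {p. snd p > E0 \<and> fst p \<in> region g d (sg j) N (snd p)} \<and> Re (F (\<xi> j E) E) = 0"
        if "E \<in> {E0<..}" for E
        using \<xi>[of E j] that unfolding ReF R_def by auto
      show "\<bar>x - y\<bar> \<le> 2 * \<bar>Re (F x E) - Re (F y E)\<bar>"
        if "(x, E) \<in> {p. snd p > E0 \<and> fst p \<in> region g d (sg j) N (snd p)}"
          "(y, E) \<in> {p. snd p > E0 \<and> fst p \<in> region g d (sg j) N (snd p)}" for x y E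
        using inj[of E x j y] that unfolding ReF R_def by auto
    qed simp
    then show "times_differentiable_on k {E0<..} (\<lambda>E. W j E n)"
      unfolding W_def
      by (intro times_differentiable_on_wave) (use \<xi>pos phase_nonzero[OF sg last] in auto)
  qed simp
  have bounds: "stationary_solution N \<gamma> E (W j E)"
      "n \<in> {1..M} \<Longrightarrow> \<bar>(cmod (W j E n))\<^sup>2 - E\<bar> \<le> 8"
      "n \<in> {M + 1..N} \<Longrightarrow> (cmod (W j E n))\<^sup>2 \<le> 8 / E" if "E > E0" for j E n
  proof -
    show "stationary_solution N \<gamma> E (W j E)" by (rule sol[OF that])
    note norm = norm[OF that]
    have mem: "\<xi> j E \<in> region g d (sg j) N E" using \<xi>(1)[OF that] unfolding R_def .
    show "\<bar>(cmod (W j E n))\<^sup>2 - E\<bar> \<le> 8" if "n \<in> {1..M}"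
    proof -
      have "\<not> N - n < d" "N - n \<le> N" using that d by auto
      then have "power_at g E (N - n) (\<xi> j E) \<in> {E - 3<..<E + 3}"
        using mem unfolding region_def by (auto dest: spec[of _ "N - n"])
      then show ?thesis unfolding norm by auto
    qed
    show "(cmod (W j E n))\<^sup>2 \<le> 8 / E" if "n \<in> {M + 1..N}"
      unfolding norm
      by (rule power_at_tail_le[OF E0(2,4)[OF \<open>E > E0\<close>] _ mem]) (use that d in auto)
  qed
  \<comment> \<open>A gauge factor 1 or -1 cancels in the product of one entry with the conjugate of
    the next. The real part of this product carries the prescribed sign, so equivalent solutions
    have equal bits.\<close>
  have distinct: "i = j" if ij: "i < 2 ^ M" "j < 2 ^ M" "E > E0" and eqv: "gauge_equivalent N (W i E) (W j E)" for i j E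
  proof (rule eq_if_same_bits[OF ij(1,2)])
    fix m assume m: "m < M"
    define k where "k = d + m"
    have k: "k \<in> {d..<N}" "Suc k \<le> N" using m d unfolding k_def by auto
    obtain \<epsilon> :: complex where \<epsilon>: "\<epsilon> = 1 \<or> \<epsilon> = -1" and eq: "\<And>n. n \<in> {1..N} \<Longrightarrow> W i E n = \<epsilon> * W j E n"
      using eqv that[of 1] that[of "-1"] unfolding gauge_equivalent_def by auto
    \<comment> \<open>The bit of site 1 involves \<open>w_0\<close>; the relation extends there
      because \<open>\<epsilon>\<close> is real.\<close>
    have "site_ext N (W i E) n = \<epsilon> * site_ext N (W j E) n" if "n \<le> N" for n
      using eq[of n] eq[of 1] that N1 \<epsilon> unfolding site_ext_def by auto
    from this[of "N - l" for l] have "W i E (N - l) = \<epsilon> * W j E (N - l)" if "l \<le> N" for l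
      using ext[OF ij(3) that, of i] ext[OF ij(3) that, of j] by simp
    then have "W i E (N - Suc k) * cnj (W i E (N - k)) = W j E (N - Suc k) * cnj (W j E (N - k))"
      using k \<epsilon> by auto
    then have "\<xi> i E * Re (shoot g (Suc k) (\<xi> i E) E * cnj (shoot g k (\<xi> i E) E))
        = \<xi> j E * Re (shoot g (Suc k) (\<xi> j E) E * cnj (shoot g k (\<xi> j E) E))"
      using link[OF ij(3), of i "N - Suc k" "N - k"] link[OF ij(3), of j "N - Suc k" "N - k"] k by simp
    moreover define a b where "a = Re (shoot g (Suc k) (\<xi> i E) E * cnj (shoot g k (\<xi> i E) E))"
      and "b = Re (shoot g (Suc k) (\<xi> j E) E * cnj (shoot g k (\<xi> j E) E))"
    ultimately have ab: "\<xi> i E * a = \<xi> j E * b" by simp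
    have "sg i k * a > 0" "sg j k * b > 0"
      using signs[OF ij(3) k(1)] unfolding a_def b_def by blast+
    moreover have "a > 0 \<longleftrightarrow> b > 0"
      using ab \<xi>pos[OF ij(3), of i] \<xi>pos[OF ij(3), of j] by (metis zero_less_mult_iff less_asym)
    ultimately have "sg i k = sg j k" using sg[of i k] sg[of j k] by auto
    then show "bit i m = bit j m" unfolding sg_def k_def by (auto split: if_splits)
  qed
  have "E0 > 0" by (simp add: E0_def less_max_iff_disj)
  show ?thesis
    by (rule exI[of _ E0], intro conjI, rule \<open>E0 > 0\<close>, rule exI[of _ 8], intro conjI, simp, rule exI[of _ W])
      (use smooth bounds distinct in blast)
qed

end
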